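(* Let $\mu$ be a unimodular probability measure on $\mathcal{G}_*$ (supported on connected, infinite graphs of uniformly bounded degree). Consider the BRW on $G$ with offspring distribution $(p_k)_{k\ge1}$ ($p_0=0$, $p_1<1$, mean $m$) and simple random walk movement. Then for $\mu$-almost every $(G,o)$: if $m>1/\rho(G)$ the BRW is strongly recurrent, and if $m\le 1/\rho(G)$ it is transient.
   Context: Graphs are infinite, connected, locally finite with uniformly bounded degrees. The simple random walk (SRW) on $G$ has transition probabilities $p(x,y)=1/\deg(x)$ if $x\sim y$ and $0$ otherwise; $\rho(G)=\limsup_{n\to\infty}(p^{(n)}(x,y))^{1/n}$ is its spectral radius (independent of $x,y$). Branching random walk (BRW) with offspring distribution $(p_k)_{k\ge0}$, $p_0=0$, $p_1<1$, $m=\sum_k kp_k$: it is the tree-indexed random walk $(S_v)_{v\in\mathbb{T}}$ where $\mathbb{T}$ is a Galton–Watson tree with offspring law $(p_k)$ rooted at $\mathbf r$, $S_{\mathbf r}=o$, and given $S_{v^-}=y$ (where $v^-$ is the parent of $v$), $S_v$ is chosen with law $p(y,\cdot)$, independently over vertices. For $x\in G$ let $\alpha(x)$ be the probability that the BRW started at $x$ visits $x$ infinitely often (i.e. infinitely many $v$ have $S_v=x$). The BRW is strongly recurrent if $\alpha(x)=1$ for all $x$, transient if $\alpha(x)=0$ for all $x$ (these do not depend on $x$ by irreducibility). $\mathcal{G}_*$ is the space of isomorphism classes $[G,o]$ of rooted locally finite connected graphs with the local topology, $\mathcal{G}_{**}$ the analogous space with an ordered pair of distinguished vertices. A Borel probability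 measure $\mu$ on $\mathcal{G}_*$ is unimodular if for every Borel $f:\mathcal{G}_{**}\to[0,\infty]$, $\int\sum_{x\in V(G)}f(G,o,x)\,d\mu([G,o])=\int\sum_{x\in V(G)}f(G,x,o)\,d\mu([G,o])$. A unimodular random graph (URG) is a random rooted graph with unimodular law. *)

theory Defs
  imports "HOL-Probability.Probability"
begin

section \<open>Graphs with vertex set nat\<close>

text \<open>A (labelled) graph is an adjacency predicate on pairs of naturals.
Every infinite, connected, locally finite graph is countably infinite, hence
isomorphic to one with vertex set UNIV :: nat set.\<close>

type_synonym graph = "nat \<times> nat \<Rightarrow> bool"

definition nbrs :: "graph \<Rightarrow> nat \<Rightarrow> nat set" where
  "nbrs G x = {y. G (x, y)}"

definition deg :: "graph \<Rightarrow> nat \<Rightarrow> nat" where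
  "deg G x = card (nbrs G x)"

text \<open>Simple, connected graph on all of nat (hence infinite), degrees bounded by D.\<close>
definition good_graph :: "graph \<Rightarrow> nat \<Rightarrow> bool" where
  "good_graph G D \<longleftrightarrow>
     (\<forall>x y. G (x, y) = G (y, x)) \<and> (\<forall>x. \<not> G (x, x)) \<and>
     (\<forall>x. finite (nbrs G x) \<and> deg G x \<le> D) \<and>
     (\<forall>x y. (x, y) \<in> {(a, b). G (a, b)}\<^sup>*)"

section \<open>Simple random walk and spectral radius\<close>

definition srw_p :: "graph \<Rightarrow> nat \<Rightarrow> nat \<Rightarrow> real" where
  "srw_p G x y = (if G (x, y) then 1 / real (deg G x) else 0)"

fun srw_pn :: "graph \<Rightarrow> nat \<Rightarrow> nat \<Rightarrow> nat \<Rightarrow> real" where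
  "srw_pn G 0 x y = (if x = y then 1 else 0)"
| "srw_pn G (Suc n) x y = (\<Sum>z\<in>nbrs G x. srw_p G x z * srw_pn G n z y)"

definition spectral_radius :: "graph \<Rightarrow> nat \<Rightarrow> nat \<Rightarrow> real" where
  "spectral_radius G x y =
     real_of_ereal (limsup (\<lambda>n. ereal (srw_pn G n x y powr (1 / real n))))"

section \<open>Branching random walk\<close>

text \<open>Sample space: to each Ulam-Harris label (a list of child indices, stored
with the most recent generation first) we attach an offspring number with law p
and an independent uniform variable in [0,1) used to pick a uniform neighbour.\<close>

definition brw_space :: "nat pmf \<Rightarrow> (nat list \<Rightarrow> nat \<times> real) measure" where
  "brw_space p = (\<Pi>\<^sub>M v\<in>UNIV. measure_pmf p \<Otimes>\<^sub>M uniform_measure lborel {0..<1})"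

fun in_tree :: "(nat list \<Rightarrow> nat \<times> real) \<Rightarrow> nat list \<Rightarrow> bool" where
  "in_tree \<omega> [] = True"
| "in_tree \<omega> (i # v) = (in_tree \<omega> v \<and> i < fst (\<omega> v))"

fun brw_pos :: "graph \<Rightarrow> nat \<Rightarrow> (nat list \<Rightarrow> nat \<times> real) \<Rightarrow> nat list \<Rightarrow> nat" where
  "brw_pos G x \<omega> [] = x"
| "brw_pos G x \<omega> (i # v) =
     (let y = brw_pos G x \<omega> v
      in sorted_list_of_set (nbrs G y) ! nat \<lfloor>snd (\<omega> (i # v)) * real (deg G y)\<rfloor>)"

text \<open>alpha(x): probability that the BRW started at x visits x infinitely often.\<close>
definition brw_alpha :: "graph \<Rightarrow> nat pmf \<Rightarrow> nat \<Rightarrow> real" where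
  "brw_alpha G p x = measure (brw_space p)
     {\<omega> \<in> space (brw_space p). infinite {v. in_tree \<omega> v \<and> brw_pos G x \<omega> v = x}}"

definition strongly_recurrent :: "graph \<Rightarrow> nat pmf \<Rightarrow> bool" where
  "strongly_recurrent G p \<longleftrightarrow> (\<forall>x. brw_alpha G p x = 1)"

definition transient :: "graph \<Rightarrow> nat pmf \<Rightarrow> bool" where
  "transient G p \<longleftrightarrow> (\<forall>x. brw_alpha G p x = 0)"

definition offspring_mean :: "nat pmf \<Rightarrow> ennreal" where
  "offspring_mean p = (\<integral>\<^sup>+ k. ennreal (real k) \<partial>measure_pmf p)"

section \<open>Unimodular random rooted graphs (via labelled representatives)\<close>

definition graph_space :: "graph measure" where
  "graph_space = (\<Pi>\<^sub>M e\<in>UNIV. count_space UNIV)"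

definition rooted_space :: "(graph \<times> nat) measure" where
  "rooted_space = graph_space \<Otimes>\<^sub>M count_space UNIV"

definition birooted_space :: "((graph \<times> nat) \<times> nat) measure" where
  "birooted_space = rooted_space \<Otimes>\<^sub>M count_space UNIV"

text \<open>f is invariant under relabelling: (G o (pi x pi), o, x) is isomorphic,
via pi, to (G, pi o, pi x).\<close>
definition iso_invariant2 :: "((graph \<times> nat) \<times> nat \<Rightarrow> ennreal) \<Rightarrow> bool" where
  "iso_invariant2 f \<longleftrightarrow>
     (\<forall>\<pi> G r x. bij \<pi> \<longrightarrow> f ((G \<circ> map_prod \<pi> \<pi>, r), x) = f ((G, \<pi> r), \<pi> x))"

definition unimodular :: "(graph \<times> nat) measure \<Rightarrow> bool" where
  "unimodular \<nu> \<longleftrightarrow> prob_space \<nu> \<and> sets \<nu> = sets rooted_space \<and>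
     (\<forall>f. f \<in> borel_measurable birooted_space \<longrightarrow> iso_invariant2 f \<longrightarrow>
        (\<integral>\<^sup>+ Gr. (\<Sum>x. f ((fst Gr, snd Gr), x)) \<partial>\<nu>) =
        (\<integral>\<^sup>+ Gr. (\<Sum>x. f ((fst Gr, x), snd Gr)) \<partial>\<nu>))"

end

theory Submission
  imports Defs
begin

text \<open>Let \<open>q\<close> be the probability of finitely many visits to a target vertex, as a function of the
  starting point, let \<open>P\<close> be the transition operator and \<open>g\<close> the offspring generating function;
  branching at the root gives \<open>q = g (P q)\<close>. On a connected graph \<open>q\<close> does not depend on the target.

  If \<open>m \<le> 1 / \<rho>\<close>, renewal shows that the expected number of first-return descendants
  \<open>\<Sum>\<^sub>k m\<^sup>k f\<^sup>k(o, o)\<close> is at most 1, and \<open>1 - g (1 - t) < m t\<close> then forces \<open>q = 1\<close>: criticality is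
  transient on every bounded degree graph. If \<open>m > 1 / \<rho>\<close>, some \<open>m\<^sup>n p\<^sup>n(o, o)\<close> exceeds 1 and the
  embedded process of returns gives \<open>q < 1\<close>, which on a general graph need not imply \<open>q = 0\<close>.

  This is where unimodularity enters: transporting the mass \<open>q(x)\<close> from \<open>o\<close> to each neighbour \<open>x\<close>
  shows that \<open>deg(o) P q(o)\<close> and \<open>deg(o) q(o)\<close> have the same mean. Since \<open>q = g (P q) \<le> P q\<close>
  pointwise, almost surely \<open>P q(o)\<close> is a fixed point of \<open>g\<close>, that is, \<open>0\<close> or \<open>1\<close>.\<close>

section \<open>The branching property\<close>

text \<open>The mass transport admits only invariant functions of a pair of vertices, whereas
  \<open>q = g (P q)\<close> holds for a fixed target and a varying starting point. Independence of
  the target reconciles the two: it identifies \<open>P q(o)\<close> with the average, over the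
  neighbours \<open>x\<close>, of the probability of finitely many returns to \<open>x\<close> from
  \<open>x\<close> itself. Bounded degrees keep the transported mass integrable, so that equal means
  of ordered functions give equality almost surely.

  At \<open>m = 1 / \<rho>\<close> the Green series
  \<open>\<Sum>\<^sub>n m\<^sup>n p\<^sup>n(o, o)\<close> may diverge, so the expected number of
  visits is of no use. The first-return series is bounded by 1 below the critical parameter, and its
  partial sums are polynomials, so the bound survives at that parameter. The strictness that then
  forces \<open>q = 1\<close> comes from branching (some offspring number is at least 2), not from
  the return series.

  Visiting probabilities are expressed as means of products of weights over the first
  \<open>n\<close> generations, because such means obey a deterministic recursion in
  \<open>g\<close> and \<open>P\<close>.\<close>

text \<open>Labels list the most recent generation first, so the descendants of the \<open>i\<close>-th child of the
  root are the labels \<open>v @ [i]\<close>.\<close>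

definition descend :: "nat \<Rightarrow> (nat list \<Rightarrow> nat \<times> real) \<Rightarrow> nat list \<Rightarrow> nat \<times> real" where
  "descend i \<xi> = (\<lambda>v. \<xi> (v @ [i]))"

definition step :: "graph \<Rightarrow> nat \<Rightarrow> real \<Rightarrow> nat" where
  "step G y u = sorted_list_of_set (nbrs G y) ! nat \<lfloor>u * real (deg G y)\<rfloor>"

definition offspring_gf :: "nat pmf \<Rightarrow> ennreal \<Rightarrow> ennreal" where
  "offspring_gf p s = (\<integral>\<^sup>+k. s ^ k \<partial>measure_pmf p)"

text \<open>The degree is written as a series too, so that the operator makes sense on every graph,
  is measurable in \<open>G\<close> term by term and commutes with relabellings. On a finite
  nonempty neighbourhood it is the average over the neighbours.\<close>

definition srw_op :: "graph \<Rightarrow> (nat \<Rightarrow> ennreal) \<Rightarrow> nat \<Rightarrow> ennreal" where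
  "srw_op G w x = (\<Sum>z. if G (x, z) then w z else 0) / (\<Sum>z. if G (x, z) then 1 else 0)"

text \<open>The recursive definitions peel off the youngest generation, at the head of a label;
  branching at the root needs the oldest one, at its end.\<close>

lemma in_tree_snoc: "in_tree \<xi> (v @ [i]) \<longleftrightarrow> i < fst (\<xi> []) \<and> in_tree (descend i \<xi>) v"
  by (induction v) (auto simp: descend_def)

text \<open>The variable at \<open>[i]\<close>, which places child \<open>i\<close>, becomes the
  root variable of the descended field.\<close>

lemma brw_pos_snoc:
  "brw_pos G x \<xi> (v @ [i]) = brw_pos G (step G x (snd (\<xi> [i]))) (descend i \<xi>) v"
  by (induction v) (auto simp: descend_def step_def Let_def)

lemma in_tree_upd: "in_tree (\<xi>(Nil := (fst (\<xi> []), u))) v = in_tree \<xi> v"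
  by (induction v) auto

lemma brw_pos_upd: "brw_pos G x (\<xi>(Nil := a)) v = brw_pos G x \<xi> v"
  by (induction v) (auto simp: Let_def)

section \<open>The probability space of labels\<close>

abbreviation gen_space :: "nat pmf \<Rightarrow> (nat \<times> real) measure" where
  "gen_space p \<equiv> measure_pmf p \<Otimes>\<^sub>M uniform_measure lborel {0..<1}"

lemma prob_space_uniform01: "prob_space (uniform_measure lborel {0..<1::real})"
  by (rule prob_space_uniform_measure) auto

lemma prob_space_gen: "prob_space (gen_space p)"
  by (intro prob_space_pair prob_space_measure_pmf prob_space_uniform01)

lemma prob_space_brw: "prob_space (brw_space p)"
  unfolding brw_space_def by (intro prob_space_PiM prob_space_gen)

lemma space_brw [simp]: "space (brw_space p) = UNIV"
  by (auto simp: brw_space_def space_PiM space_pair_measure)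

lemma measurable_label [measurable]: "(\<lambda>\<xi>. \<xi> v) \<in> measurable (brw_space p) (gen_space p)"
  unfolding brw_space_def by (rule measurable_component_singleton) auto

lemma measurable_fst_label [measurable]:
  "(\<lambda>\<xi>. fst (\<xi> v)) \<in> measurable (brw_space p) (count_space UNIV)"
  using measurable_compose[OF measurable_label[of v p] measurable_fst] by simp

lemma measurable_snd_label [measurable]:
  "(\<lambda>\<xi>. snd (\<xi> v)) \<in> borel_measurable (brw_space p)"
proof -
  have "snd \<in> borel_measurable (gen_space p)"
    using measurable_snd[of "measure_pmf p" "uniform_measure lborel {0..<1::real}"]
    by (simp cong: measurable_cong_sets)
  from measurable_compose[OF measurable_label this] show ?thesis by simp
qed

lemma measurable_step [measurable]: "step G x \<in> measurable borel (count_space UNIV)"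
  unfolding step_def by measurable

lemma measurable_descend [measurable]: "descend i \<in> measurable (brw_space p) (brw_space p)"
  unfolding descend_def brw_space_def
  by (rule measurable_PiM_single') (auto simp: space_PiM)

lemma measurable_in_tree [measurable]: "Measurable.pred (brw_space p) (\<lambda>\<xi>. in_tree \<xi> v)"
  by (induction v) auto

lemma measurable_brw_pos [measurable]:
  "(\<lambda>\<xi>. brw_pos G x \<xi> v) \<in> measurable (brw_space p) (count_space UNIV)"
proof (induction v)
  case (Cons i v)
  have [measurable]: "(\<lambda>\<xi>. brw_pos G x \<xi> v) \<in> measurable (brw_space p) (count_space UNIV)"
    by (rule Cons)
  have *: "brw_pos G x \<xi> (i # v) = step G (brw_pos G x \<xi> v) (snd (\<xi> (i # v)))" for \<xi>
    by (simp add: step_def Let_def)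
  show ?case unfolding *
    by (rule measurable_compose_countable[where g="\<lambda>\<xi>. brw_pos G x \<xi> v"]) measurable
qed auto

lemma distr_descend: "distr (brw_space p) (brw_space p) (descend i) = brw_space p"
proof -
  have "distr (brw_space p) (brw_space p) (\<lambda>\<xi>. \<lambda>v\<in>UNIV. \<xi> (v @ [i])) = brw_space p"
    unfolding brw_space_def
    by (rule distr_PiM_reindex[of UNIV "\<lambda>_. gen_space p"])
       (auto simp: inj_on_def prob_space_gen)
  then show ?thesis by (simp add: descend_def[abs_def] restrict_UNIV)
qed

lemma indep_labels:
  "prob_space.indep_vars (brw_space p) (\<lambda>_. gen_space p) (\<lambda>v \<xi>. \<xi> v) UNIV"
proof -
  interpret prob_space "brw_space p" by (rule prob_space_brw)
  have "distr (brw_space p) (gen_space p) (\<lambda>\<xi>. \<xi> v) = gen_space p" for v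
    unfolding brw_space_def by (rule distr_PiM_component) (auto simp: prob_space_gen)
  moreover have "distr (brw_space p) (PiM UNIV (\<lambda>_. gen_space p)) (\<lambda>x. \<lambda>i\<in>UNIV. x i) = brw_space p"
    by (simp add: restrict_UNIV brw_space_def[symmetric] distr_id2[OF refl])
  ultimately show ?thesis
    by (subst indep_vars_iff_distr_eq_PiM) (auto simp: brw_space_def[symmetric])
qed

text \<open>The \<open>d\<close> intervals \<open>[j/d, (j+1)/d)\<close> have equal length, and on
  each of them \<open>step\<close> picks the \<open>j\<close>-th neighbour.\<close>

lemma nn_integral_step:
  assumes fin: "finite (nbrs G x)" and ne: "nbrs G x \<noteq> {}"
  shows "(\<integral>\<^sup>+u. F (step G x u) \<partial>uniform_measure lborel {0..<1}) = srw_op G F x"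
proof -
  define d where "d = deg G x"
  define L where "L = sorted_list_of_set (nbrs G x)"
  have d: "d > 0" "length L = d" and L: "distinct L" "set L = nbrs G x"
    using fin ne by (auto simp: d_def L_def deg_def card_gt_0_iff)
  have one: "F (step G x u) * indicator {0..<1} u =
      (\<Sum>j<d. F (L ! j) * indicator {real j / d..<real (Suc j) / d} u)" for u
  proof (cases "u \<in> {0..<1}")
    case True
    define j where "j = nat \<lfloor>u * d\<rfloor>"
    have "u * d < d" using True d by (simp add: field_simps)
    have u0: "0 \<le> u * d" using True by simp
    have rj: "real j = of_int \<lfloor>u * d\<rfloor>" using u0 by (simp add: j_def)
    have j: "real j \<le> u * d" "u * d < real j + 1" using rj by linarith+
    have "j < d" using j \<open>u * d < d\<close> by linarith
    have iff: "u \<in> {real i / d..<real (Suc i) / d} \<longleftrightarrow> i = j" for i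
    proof -
      have "u \<in> {real i / d..<real (Suc i) / d} \<longleftrightarrow> real i \<le> u * d \<and> u * d < real i + 1"
        using d by (auto simp: field_simps)
      also have "\<dots> \<longleftrightarrow> i = j" using j by auto
      finally show ?thesis .
    qed
    have "(\<Sum>i<d. F (L ! i) * indicator {real i / d..<real (Suc i) / d} u) =
        (\<Sum>i<d. if i = j then F (L ! j) else 0)"
      by (rule sum.cong) (use iff in \<open>auto simp: indicator_def\<close>)
    then show ?thesis using True \<open>j < d\<close> by (simp add: step_def L_def d_def j_def)
  next
    case False
    have "u \<notin> {real i / d..<real (Suc i) / d}" if "i < d" for i
    proof
      assume *: "u \<in> {real i / d..<real (Suc i) / d}"
      have "real (Suc i) / d \<le> 1" "0 \<le> real i / d" using that d by (auto simp: field_simps)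
      moreover have "real i / d \<le> u" "u < real (Suc i) / d" using * by auto
      ultimately have "u \<in> {0..<1}" unfolding atLeastLessThan_iff by linarith
      then show False using False by blast
    qed
    then have "(\<Sum>j<d. F (L ! j) * indicator {real j / d..<real (Suc j) / d} u) = 0"
      by (intro sum.neutral) (auto simp del: of_nat_Suc)
    then show ?thesis using False by simp
  qed
  have [measurable]: "(\<lambda>u. F (step G x u)) \<in> borel_measurable borel"
    by (rule measurable_compose[OF measurable_step]) simp
  have len: "emeasure lborel {real j / d..<real (Suc j) / d} = 1 / ennreal (real d)" for j
  proof -
    have "real (Suc j) / d - real j / d = 1 / d" by (simp add: add_divide_distrib)
    moreover have "real j / d \<le> real (Suc j) / d" by (simp add: divide_right_mono)
    ultimately show ?thesis using d divide_ennreal[of 1 "real d"] by (simp del: of_nat_Suc)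
  qed
  have "(\<integral>\<^sup>+u. F (step G x u) \<partial>uniform_measure lborel {0..<1}) =
      (\<integral>\<^sup>+u. F (step G x u) * indicator {0..<1} u \<partial>lborel)"
    by (subst nn_integral_uniform_measure) (auto simp: divide_ennreal_def)
  also have "\<dots> = (\<Sum>j<d. F (L ! j) * (1 / ennreal (real d)))"
    by (subst one, subst nn_integral_sum) (simp_all add: nn_integral_cmult_indicator len del: of_nat_Suc)
  also have "\<dots> = (\<Sum>j<d. F (L ! j)) / ennreal (real d)"
    by (simp add: divide_ennreal_def sum_distrib_right)
  also have "(\<Sum>j<d. F (L ! j)) = (\<Sum>z\<in>nbrs G x. F z)"
    using L d by (intro sum.reindex_bij_betw bij_betw_nth) auto
  also have "(\<Sum>z\<in>nbrs G x. F z) = (\<Sum>z. if G (x, z) then F z else 0)"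
    using fin by (subst suminf_finite[of "nbrs G x"]) (auto simp: nbrs_def intro: sum.cong)
  also have "ennreal (real d) = (\<Sum>z. if G (x, z) then 1 else 0)"
    using fin by (subst suminf_finite[of "nbrs G x"]) 
      (auto simp: nbrs_def d_def deg_def ennreal_of_nat_eq_real_of_nat intro: sum.cong)
  finally show ?thesis by (simp add: srw_op_def)
qed

text \<open>The invariance assumption says that \<open>X z\<close> ignores the uniform variable at the root, which is
  the one used to choose the starting point of the subtree.\<close>

lemma nn_integral_first_step:
  assumes fin: "finite (nbrs G x)" and ne: "nbrs G x \<noteq> {}"
    and X[measurable]: "\<And>z. X z \<in> borel_measurable (brw_space p)"
    and Xinv: "\<And>z \<xi> u. X z (\<xi>(Nil := (fst (\<xi> []), u))) = X z \<xi>"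
  shows "(\<integral>\<^sup>+\<xi>. X (step G x (snd (\<xi> []))) \<xi> \<partial>brw_space p) =
    srw_op G (\<lambda>z. \<integral>\<^sup>+\<xi>. X z \<xi> \<partial>brw_space p) x"
proof -
  let ?U = "uniform_measure lborel {0..<1::real}"
  let ?R = "PiM (UNIV - {[]}) (\<lambda>_::nat list. gen_space p)"
  interpret U: prob_space ?U by (rule prob_space_uniform01)
  interpret R: prob_space ?R by (intro prob_space_PiM prob_space_gen)
  interpret N: prob_space "gen_space p" by (rule prob_space_gen)
  interpret UR: pair_prob_space ?U ?R ..
  \<comment> \<open>\<open>T\<close> puts the root coordinate back into the remaining field and
    carries the product measure to the law of the whole field. This splits off the root, and then
    its offspring number from its uniform variable.\<close>
  define T where "T = (\<lambda>(a, \<eta>). (\<eta>(Nil := a)) :: nat list \<Rightarrow> nat \<times> real)"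
  have dist: "distr (gen_space p \<Otimes>\<^sub>M ?R) (brw_space p) T = brw_space p"
    using distr_pair_PiM_eq_PiM[of "UNIV - {[]}" "\<lambda>_. gen_space p" "[]"]
    by (simp add: prob_space_gen brw_space_def T_def insert_UNIV)
  have T[measurable]: "T \<in> measurable (gen_space p \<Otimes>\<^sub>M ?R) (brw_space p)"
    unfolding T_def brw_space_def
    using measurable_fun_upd[of UNIV "UNIV - {[]}" "[]" snd "gen_space p \<Otimes>\<^sub>M ?R" "\<lambda>_. gen_space p" fst]
    by (auto simp: insert_UNIV case_prod_beta)
  have expand: "(\<integral>\<^sup>+\<xi>. Y \<xi> \<partial>brw_space p) = (\<integral>\<^sup>+k. \<integral>\<^sup>+u. \<integral>\<^sup>+\<eta>. Y (\<eta>(Nil := (k, u))) \<partial>?R \<partial>?U \<partial>measure_pmf p)"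
    if Y[measurable]: "Y \<in> borel_measurable (brw_space p)" for Y
  proof -
    have "(\<integral>\<^sup>+\<xi>. Y \<xi> \<partial>brw_space p) = (\<integral>\<^sup>+a. Y (T a) \<partial>(gen_space p \<Otimes>\<^sub>M ?R))"
      by (subst dist[symmetric], subst nn_integral_distr) auto
    also have "\<dots> = (\<integral>\<^sup>+a. \<integral>\<^sup>+\<eta>. Y (T (a, \<eta>)) \<partial>?R \<partial>gen_space p)"
      by (subst R.nn_integral_fst[symmetric]) auto
    also have "\<dots> = (\<integral>\<^sup>+k. \<integral>\<^sup>+u. \<integral>\<^sup>+\<eta>. Y (T ((k, u), \<eta>)) \<partial>?R \<partial>?U \<partial>measure_pmf p)"
      by (subst U.nn_integral_fst[symmetric]) auto
    finally show ?thesis by (simp add: T_def)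
  qed
  \<comment> \<open>By the invariance assumption the uniform variable may be set to 0 here; it then
    acts only through the choice of the starting vertex.\<close>
  define h where "h z k = (\<integral>\<^sup>+\<eta>. X z (\<eta>(Nil := (k, 0))) \<partial>?R)" for z k
  have inv: "X z (\<eta>(Nil := (k, u))) = X z (\<eta>(Nil := (k, 0)))" for z \<eta> k u
    using Xinv[of z "\<eta>(Nil := (k, 0))" u] by simp
  have E: "(\<integral>\<^sup>+\<xi>. X z \<xi> \<partial>brw_space p) = (\<integral>\<^sup>+k. h z k \<partial>measure_pmf p)" for z
    by (subst expand[OF X], subst inv) (simp add: h_def[abs_def] U.emeasure_space_1)
  have meas: "(\<lambda>\<xi>. X (step G x (snd (\<xi> []))) \<xi>) \<in> borel_measurable (brw_space p)"
    by (rule measurable_compose_countable[where g="\<lambda>\<xi>. step G x (snd (\<xi> []))"]) measurable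
  have "(\<integral>\<^sup>+\<xi>. X (step G x (snd (\<xi> []))) \<xi> \<partial>brw_space p) =
     (\<integral>\<^sup>+k. \<integral>\<^sup>+u. h (step G x u) k \<partial>?U \<partial>measure_pmf p)"
    by (subst expand[OF meas], subst inv) (simp add: h_def)
  also have "\<dots> = (\<integral>\<^sup>+k. srw_op G (\<lambda>z. h z k) x \<partial>measure_pmf p)"
    by (subst nn_integral_step[OF fin ne, where F="\<lambda>z. h z _"]) simp
  also have "\<dots> = srw_op G (\<lambda>z. \<integral>\<^sup>+k. h z k \<partial>measure_pmf p) x"
    unfolding srw_op_def
    by (subst nn_integral_divide, simp, subst nn_integral_suminf, simp,
        intro arg_cong2[where f="(/)"] arg_cong[where f=suminf] ext) auto
  finally show ?thesis by (simp add: E)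
qed

text \<open>Given the number of children, the subtrees live on disjoint sets of labels, hence are
  independent, each with the law of the whole field.\<close>

lemma nn_integral_prod_children:
  assumes Y[measurable]: "Y \<in> borel_measurable (brw_space p)"
  shows "(\<integral>\<^sup>+\<xi>. (\<Prod>i<fst (\<xi> []). Y (descend i \<xi>)) \<partial>brw_space p) =
    offspring_gf p (\<integral>\<^sup>+\<xi>. Y \<xi> \<partial>brw_space p)"
proof -
  interpret M: prob_space "brw_space p" by (rule prob_space_brw)
  \<comment> \<open>Block 0 is the root, block \<open>Suc i\<close> the set of labels descending
    from child \<open>i\<close>.\<close>
  define K where "K j = (case j of 0 \<Rightarrow> {[]} | Suc i \<Rightarrow> range (\<lambda>v. v @ [i]))" for j :: nat
  have disj: "disjoint_family_on K UNIV"
    by (auto simp: disjoint_family_on_def K_def split: nat.splits)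
  have ind: "M.indep_vars (\<lambda>j. PiM (K j) (\<lambda>_. gen_space p)) (\<lambda>j \<xi>. restrict (\<lambda>v. \<xi> v) (K j)) UNIV"
    by (rule M.indep_vars_restrict[OF indep_labels _ disj]) auto
  have EY: "(\<integral>\<^sup>+\<xi>. Y (descend i \<xi>) \<partial>brw_space p) = (\<integral>\<^sup>+\<xi>. Y \<xi> \<partial>brw_space p)" for i
    by (subst (2) distr_descend[of p i, symmetric], subst nn_integral_distr) auto
  have term_k: "(\<integral>\<^sup>+\<xi>. indicator {k} (fst (\<xi> [])) * (\<Prod>i<k. Y (descend i \<xi>)) \<partial>brw_space p) =
      ennreal (pmf p k) * (\<integral>\<^sup>+\<xi>. Y \<xi> \<partial>brw_space p) ^ k" for k
  proof -
    define Z where "Z j = (\<lambda>\<eta>::nat list \<Rightarrow> nat \<times> real. case j of 0 \<Rightarrow> indicator {k} (fst (\<eta> [])) | Suc i \<Rightarrow> Y (\<lambda>v. \<eta> (v @ [i])))" for j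
    have Z: "Z j \<in> borel_measurable (PiM (K j) (\<lambda>_. gen_space p))" for j
    proof (cases j)
      case 0
      have "(\<lambda>\<eta>::nat list \<Rightarrow> nat \<times> real. fst (\<eta> [])) \<in> measurable (PiM {[]} (\<lambda>_. gen_space p)) (measure_pmf p)"
        by measurable
      then have "(\<lambda>\<eta>::nat list \<Rightarrow> nat \<times> real. fst (\<eta> [])) \<in> measurable (PiM {[]} (\<lambda>_. gen_space p)) (count_space UNIV)"
        by simp
      from measurable_compose[OF this, of "indicator {k}" borel] show ?thesis
        by (simp add: Z_def 0 K_def)
    next
      case (Suc i)
      have "(\<lambda>\<eta> v. \<eta> (v @ [i])) \<in> measurable (PiM (range (\<lambda>v. v @ [i])) (\<lambda>_. gen_space p)) (brw_space p)"
        unfolding brw_space_def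
        by (rule measurable_PiM_single') (auto simp: space_PiM space_pair_measure)
      from measurable_compose[OF this Y] show ?thesis by (simp add: Z_def Suc K_def)
    qed
    have ind2: "M.indep_vars (\<lambda>_. borel) (\<lambda>j \<xi>. Z j (restrict (\<lambda>v. \<xi> v) (K j))) {..k}"
      by (rule M.indep_vars_subset[OF M.indep_vars_compose2[OF ind Z]]) auto
    have Z0: "Z 0 (restrict (\<lambda>v. \<xi> v) (K 0)) = indicator {k} (fst (\<xi> []))" for \<xi>
      by (simp add: Z_def K_def)
    have ZS: "Z (Suc i) (restrict (\<lambda>v. \<xi> v) (K (Suc i))) = Y (descend i \<xi>)" for \<xi> i
      by (simp add: Z_def K_def descend_def)
    have "(\<integral>\<^sup>+\<xi>. indicator {k} (fst (\<xi> [])) * (\<Prod>i<k. Y (descend i \<xi>)) \<partial>brw_space p) =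
       (\<integral>\<^sup>+\<xi>. (\<Prod>j\<le>k. Z j (restrict (\<lambda>v. \<xi> v) (K j))) \<partial>brw_space p)"
      by (simp add: lessThan_Suc_atMost[symmetric] prod.lessThan_Suc_shift Z0 ZS del: prod.lessThan_Suc)
    also have "\<dots> = (\<Prod>j\<le>k. \<integral>\<^sup>+\<xi>. Z j (restrict (\<lambda>v. \<xi> v) (K j)) \<partial>brw_space p)"
      by (rule M.indep_vars_nn_integral) (use ind2 in auto)
    also have "\<dots> = (\<integral>\<^sup>+\<xi>. indicator {k} (fst (\<xi> [])) \<partial>brw_space p) *
        (\<Prod>i<k. \<integral>\<^sup>+\<xi>. Y (descend i \<xi>) \<partial>brw_space p)"
      by (simp add: lessThan_Suc_atMost[symmetric] prod.lessThan_Suc_shift Z0 ZS del: prod.lessThan_Suc)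
    also have "(\<Prod>i<k. \<integral>\<^sup>+\<xi>. Y (descend i \<xi>) \<partial>brw_space p) = (\<integral>\<^sup>+\<xi>. Y \<xi> \<partial>brw_space p) ^ k"
      by (simp add: EY)
    also have "(\<integral>\<^sup>+\<xi>. indicator {k} (fst (\<xi> [])) \<partial>brw_space p) = ennreal (pmf p k)"
    proof -
      interpret U: prob_space "uniform_measure lborel {0..<1::real}" by (rule prob_space_uniform01)
      have [measurable]: "(\<lambda>a. indicator {k} (fst a) :: ennreal) \<in> borel_measurable (gen_space p)"
        by (rule measurable_compose[OF measurable_fst]) simp
      have "(\<integral>\<^sup>+\<xi>. indicator {k} (fst (\<xi> [])) \<partial>brw_space p) =
          (\<integral>\<^sup>+a. indicator {k} (fst a) \<partial>distr (brw_space p) (gen_space p) (\<lambda>\<xi>. \<xi> []))"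
        by (subst nn_integral_distr) auto
      also have "distr (brw_space p) (gen_space p) (\<lambda>\<xi>. \<xi> []) = gen_space p"
        unfolding brw_space_def by (rule distr_PiM_component) (auto simp: prob_space_gen)
      also have "(\<integral>\<^sup>+a. indicator {k} (fst a) \<partial>gen_space p) = ennreal (pmf p k)"
        by (subst U.nn_integral_fst[symmetric]) (auto simp: U.emeasure_space_1 emeasure_pmf_single)
      finally show ?thesis .
    qed
    finally show ?thesis by simp
  qed
  have [measurable]: "(\<lambda>\<xi>. indicator {k} (fst (\<xi> [])) :: ennreal) \<in> borel_measurable (brw_space p)" for k
    by (rule measurable_compose[OF measurable_fst_label]) simp
  have "(\<integral>\<^sup>+\<xi>. (\<Prod>i<fst (\<xi> []). Y (descend i \<xi>)) \<partial>brw_space p) =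
      (\<integral>\<^sup>+\<xi>. (\<Sum>k. indicator {k} (fst (\<xi> [])) * (\<Prod>i<k. Y (descend i \<xi>))) \<partial>brw_space p)"
  proof (rule nn_integral_cong)
    fix \<xi>
    have "(\<Sum>k. indicator {k} (fst (\<xi> [])) * (\<Prod>i<k. Y (descend i \<xi>))) =
       (\<Sum>k\<in>{fst (\<xi> [])}. indicator {k} (fst (\<xi> [])) * (\<Prod>i<k. Y (descend i \<xi>)))"
      by (rule suminf_finite) auto
    then show "(\<Prod>i<fst (\<xi> []). Y (descend i \<xi>)) =
      (\<Sum>k. indicator {k} (fst (\<xi> [])) * (\<Prod>i<k. Y (descend i \<xi>)))" by simp
  qed
  also have "\<dots> = (\<Sum>k. ennreal (pmf p k) * (\<integral>\<^sup>+\<xi>. Y \<xi> \<partial>brw_space p) ^ k)"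
    by (subst nn_integral_suminf) (auto simp: term_k)
  also have "\<dots> = offspring_gf p (\<integral>\<^sup>+\<xi>. Y \<xi> \<partial>brw_space p)"
    by (simp add: offspring_gf_def nn_integral_measure_pmf nn_integral_count_space_nat)
  finally show ?thesis .
qed

text \<open>The placement of child \<open>i\<close> and the evolution of its subtree form one
  function of the descended field, because the variable at \<open>[i]\<close> is the root variable
  of that field. The mean of this function is the first-step average.\<close>

lemma nn_integral_branching:
  assumes "finite (nbrs G x)" "nbrs G x \<noteq> {}"
    and X[measurable]: "\<And>z. X z \<in> borel_measurable (brw_space p)"
    and "\<And>z \<xi> u. X z (\<xi>(Nil := (fst (\<xi> []), u))) = X z \<xi>"
  shows "(\<integral>\<^sup>+\<xi>. (\<Prod>i<fst (\<xi> []). X (step G x (snd (\<xi> [i]))) (descend i \<xi>)) \<partial>brw_space p) =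
    offspring_gf p (srw_op G (\<lambda>z. \<integral>\<^sup>+\<xi>. X z \<xi> \<partial>brw_space p) x)"
proof -
  have "(\<lambda>\<xi>. X (step G x (snd (\<xi> []))) \<xi>) \<in> borel_measurable (brw_space p)"
    by (rule measurable_compose_countable[where g="\<lambda>\<xi>. step G x (snd (\<xi> []))"]) measurable
  from nn_integral_prod_children[OF this] show ?thesis
    by (subst nn_integral_first_step[OF assms, symmetric]) (simp add: descend_def)
qed

section \<open>Multiplicative functionals of the branching random walk\<close>

definition tree_upto :: "(nat list \<Rightarrow> nat \<times> real) \<Rightarrow> nat \<Rightarrow> nat list set" where
  "tree_upto \<xi> n = {v. in_tree \<xi> v \<and> length v \<le> n}"

text \<open>Weights in {0, 1} encode avoidance events, weights above 1 exponential rewards.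
  Dependence on the generation lets a condition start at generation \<open>k\<close>.\<close>

definition weight_prod ::
  "graph \<Rightarrow> (nat \<Rightarrow> nat \<Rightarrow> ennreal) \<Rightarrow> nat \<Rightarrow> nat \<Rightarrow> (nat list \<Rightarrow> nat \<times> real) \<Rightarrow> ennreal" where
  "weight_prod G \<phi> n x \<xi> = (\<Prod>v\<in>tree_upto \<xi> n. \<phi> (length v) (brw_pos G x \<xi> v))"

text \<open>The recursion sees the graph only through the adjacency relation, not through the
  ordering of neighbours used by \<open>brw_pos\<close>.\<close>

fun weight_val :: "graph \<Rightarrow> nat pmf \<Rightarrow> nat \<Rightarrow> (nat \<Rightarrow> nat \<Rightarrow> ennreal) \<Rightarrow> nat \<Rightarrow> ennreal" where
  "weight_val G p 0 \<phi> x = \<phi> 0 x"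
| "weight_val G p (Suc n) \<phi> x =
     \<phi> 0 x * offspring_gf p (srw_op G (weight_val G p n (\<lambda>l. \<phi> (Suc l))) x)"

lemma in_tree_descend_iff:
  "in_tree \<xi> v \<longleftrightarrow> v = [] \<or> (\<exists>i w. v = w @ [i] \<and> i < fst (\<xi> []) \<and> in_tree (descend i \<xi>) w)"
  by (cases v rule: rev_cases) (auto simp: in_tree_snoc)

lemma tree_upto_0: "tree_upto \<xi> 0 = {[]}"
  by (auto simp: tree_upto_def)

lemma tree_upto_Suc:
  "tree_upto \<xi> (Suc n) = insert [] (\<Union>i<fst (\<xi> []). (\<lambda>v. v @ [i]) ` tree_upto (descend i \<xi>) n)"
  by (auto simp: tree_upto_def in_tree_descend_iff[of \<xi>] image_iff)

lemma finite_tree_upto [simp]: "finite (tree_upto \<xi> n)"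
  by (induction n arbitrary: \<xi>) (auto simp: tree_upto_0 tree_upto_Suc)

lemma weight_prod_0: "weight_prod G \<phi> 0 x \<xi> = \<phi> 0 x"
  by (simp add: weight_prod_def tree_upto_0)

lemma weight_prod_Suc:
  "weight_prod G \<phi> (Suc n) x \<xi> = \<phi> 0 x *
     (\<Prod>i<fst (\<xi> []). weight_prod G (\<lambda>l. \<phi> (Suc l)) n (step G x (snd (\<xi> [i]))) (descend i \<xi>))"
proof -
  let ?B = "\<lambda>i. (\<lambda>v. v @ [i]) ` tree_upto (descend i \<xi>) n"
  have "weight_prod G \<phi> (Suc n) x \<xi> =
      \<phi> 0 x * (\<Prod>v\<in>(\<Union>i<fst (\<xi> []). ?B i). \<phi> (length v) (brw_pos G x \<xi> v))"
    unfolding weight_prod_def tree_upto_Suc by (subst prod.insert) auto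
  also have "(\<Prod>v\<in>(\<Union>i<fst (\<xi> []). ?B i). \<phi> (length v) (brw_pos G x \<xi> v)) =
      (\<Prod>i<fst (\<xi> []). \<Prod>v\<in>?B i. \<phi> (length v) (brw_pos G x \<xi> v))"
    by (subst prod.UNION_disjoint) auto
  also have "\<dots> = (\<Prod>i<fst (\<xi> []). weight_prod G (\<lambda>l. \<phi> (Suc l)) n (step G x (snd (\<xi> [i]))) (descend i \<xi>))"
    unfolding weight_prod_def
    by (rule prod.cong[OF refl]) (simp add: prod.reindex inj_on_def brw_pos_snoc)
  finally show ?thesis .
qed

lemma measurable_weight_prod [measurable]:
  "weight_prod G \<phi> n x \<in> borel_measurable (brw_space p)"
proof (induction n arbitrary: \<phi> x)
  case 0
  then show ?case by (simp add: weight_prod_0[abs_def])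
next
  case (Suc n)
  note [measurable] = Suc
  have *: "(\<lambda>\<xi>. weight_prod G \<psi> n (step G x (snd (\<xi> [i]))) (descend i \<xi>)) \<in> borel_measurable (brw_space p)" for i \<psi>
    by (rule measurable_compose_countable[where g="\<lambda>\<xi>. step G x (snd (\<xi> [i]))"]) measurable
  have "(\<lambda>\<xi>. \<Prod>i<fst (\<xi> []). weight_prod G (\<lambda>l. \<phi> (Suc l)) n (step G x (snd (\<xi> [i]))) (descend i \<xi>))
      \<in> borel_measurable (brw_space p)"
    by (rule measurable_compose_countable[where g="\<lambda>\<xi>. fst (\<xi> [])"]) (auto intro!: borel_measurable_prod *)
  then show ?case by (simp add: weight_prod_Suc[abs_def])
qed

lemma weight_prod_upd: "weight_prod G \<phi> n x (\<xi>(Nil := (fst (\<xi> []), u))) = weight_prod G \<phi> n x \<xi>"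
  by (simp add: weight_prod_def tree_upto_def in_tree_upd brw_pos_upd)

text \<open>The branching property, iterated: below the root, the subtrees carry the weights shifted
  by one generation.\<close>

lemma nn_integral_weight_prod:
  assumes "\<And>x. finite (nbrs G x)" "\<And>x. nbrs G x \<noteq> {}"
  shows "(\<integral>\<^sup>+\<xi>. weight_prod G \<phi> n x \<xi> \<partial>brw_space p) = weight_val G p n \<phi> x"
proof (induction n arbitrary: \<phi> x)
  case 0
  interpret prob_space "brw_space p" by (rule prob_space_brw)
  show ?case using emeasure_space_1 by (simp add: weight_prod_0)
next
  case (Suc n)
  have "(\<lambda>\<xi>. \<Prod>i<fst (\<xi> []). weight_prod G (\<lambda>l. \<phi> (Suc l)) n (step G x (snd (\<xi> [i]))) (descend i \<xi>))
      \<in> borel_measurable (brw_space p)"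
    by (rule measurable_compose_countable[where g="\<lambda>\<xi>. fst (\<xi> [])"])
      (auto intro!: borel_measurable_prod measurable_compose_countable[where g="\<lambda>\<xi>. step G x (snd (\<xi> [_]))"])
  then show ?case
    using nn_integral_branching[OF assms, where X="weight_prod G (\<lambda>l. \<phi> (Suc l)) n", OF measurable_weight_prod weight_prod_upd]
    by (simp add: weight_prod_Suc nn_integral_cmult Suc)
qed

section \<open>Probabilities of finitely many visits\<close>

definition visits :: "graph \<Rightarrow> nat \<Rightarrow> nat \<Rightarrow> (nat list \<Rightarrow> nat \<times> real) \<Rightarrow> nat list set" where
  "visits G o' x \<xi> = {v. in_tree \<xi> v \<and> brw_pos G x \<xi> v = o'}"

definition fin_prob :: "graph \<Rightarrow> nat pmf \<Rightarrow> nat \<Rightarrow> nat \<Rightarrow> ennreal" where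
  "fin_prob G p o' x = emeasure (brw_space p) {\<xi>. finite (visits G o' x \<xi>)}"

definition avoid_weight :: "nat \<Rightarrow> nat \<Rightarrow> nat \<Rightarrow> nat \<Rightarrow> ennreal" where
  "avoid_weight o' k l z = (if k \<le> l \<and> z = o' then 0 else 1)"

text \<open>The tree is locally finite, so infinitely many visits must reach arbitrarily deep
  generations.\<close>

lemma finite_visits_iff: "finite (visits G o' x \<xi>) \<longleftrightarrow> (\<exists>k. \<forall>v\<in>visits G o' x \<xi>. length v < k)"
proof
  assume "finite (visits G o' x \<xi>)"
  then have "\<forall>v\<in>visits G o' x \<xi>. length v < Suc (Max (length ` visits G o' x \<xi>))"
    by (auto simp: less_Suc_eq_le)
  then show "\<exists>k. \<forall>v\<in>visits G o' x \<xi>. length v < k" ..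
next
  assume "\<exists>k. \<forall>v\<in>visits G o' x \<xi>. length v < k"
  then obtain k where "\<forall>v\<in>visits G o' x \<xi>. length v < k" ..
  then have "visits G o' x \<xi> \<subseteq> tree_upto \<xi> k"
    by (auto simp: visits_def tree_upto_def)
  then show "finite (visits G o' x \<xi>)" by (rule finite_subset) simp
qed

text \<open>A visit by the root itself does not affect finiteness. Hence the branching equation has
  no factor for the root, even when the walk starts at the target.\<close>

lemma finite_visits_descend:
  "finite (visits G o' x \<xi>) \<longleftrightarrow>
    (\<forall>i<fst (\<xi> []). finite (visits G o' (step G x (snd (\<xi> [i]))) (descend i \<xi>)))"
proof -
  let ?B = "\<lambda>i. (\<lambda>v. v @ [i]) ` visits G o' (step G x (snd (\<xi> [i]))) (descend i \<xi>)"
  have "visits G o' x \<xi> - {[]} = (\<Union>i<fst (\<xi> []). ?B i)"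
    unfolding visits_def by (auto simp: in_tree_descend_iff[of \<xi>] brw_pos_snoc image_iff)
  then have "finite (visits G o' x \<xi>) \<longleftrightarrow> (\<forall>i<fst (\<xi> []). finite (?B i))"
    by (metis (no_types, lifting) finite.emptyI finite_Diff2 finite_insert finite_UN finite_lessThan lessThan_iff)
  also have "\<dots> \<longleftrightarrow> (\<forall>i<fst (\<xi> []). finite (visits G o' (step G x (snd (\<xi> [i]))) (descend i \<xi>)))"
    by (subst finite_image_iff) (auto simp: inj_on_def)
  finally show ?thesis .
qed

lemma sets_finite_visits [measurable]: "{\<xi>. finite (visits G o' x \<xi>)} \<in> sets (brw_space p)"
proof -
  have "Measurable.pred (brw_space p) (\<lambda>\<xi>. \<exists>k. \<forall>v. in_tree \<xi> v \<and> brw_pos G x \<xi> v = o' \<longrightarrow> length v < k)"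
    by measurable
  then show ?thesis
    unfolding finite_visits_iff by (simp add: visits_def pred_def)
qed

lemma fin_prob_branching:
  assumes "\<And>x. finite (nbrs G x)" "\<And>x. nbrs G x \<noteq> {}"
  shows "fin_prob G p o' x = offspring_gf p (srw_op G (fin_prob G p o') x)"
proof -
  define X where "X z = (indicator {\<xi>. finite (visits G o' z \<xi>)} :: _ \<Rightarrow> ennreal)" for z
  have X: "X z \<in> borel_measurable (brw_space p)" for z unfolding X_def by simp
  have inv: "X z (\<xi>(Nil := (fst (\<xi> []), u))) = X z \<xi>" for z \<xi> u
    by (simp add: X_def visits_def in_tree_upd brw_pos_upd indicator_def)
  have XX: "X x \<xi> = (\<Prod>i<fst (\<xi> []). X (step G x (snd (\<xi> [i]))) (descend i \<xi>))" for \<xi>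
    unfolding X_def indicator_def using finite_visits_descend[of G o' x \<xi>]
    by (auto intro!: prod.neutral[symmetric] prod_zero[symmetric])
  have "fin_prob G p o' x = (\<integral>\<^sup>+\<xi>. X x \<xi> \<partial>brw_space p)"
    by (simp add: fin_prob_def X_def)
  also have "\<dots> = (\<integral>\<^sup>+\<xi>. (\<Prod>i<fst (\<xi> []). X (step G x (snd (\<xi> [i]))) (descend i \<xi>)) \<partial>brw_space p)"
    by (intro nn_integral_cong XX)
  finally show ?thesis
    using nn_integral_branching[OF assms, where X=X, OF X inv]
    by (simp add: X_def fin_prob_def[abs_def])
qed

lemma weight_prod_avoid:
  "weight_prod G (avoid_weight o' k) n x \<xi> =
     indicator {\<xi>. \<forall>v\<in>visits G o' x \<xi>. k \<le> length v \<longrightarrow> n < length v} \<xi>"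
proof (cases "\<forall>v\<in>visits G o' x \<xi>. k \<le> length v \<longrightarrow> n < length v")
  case True
  then have "weight_prod G (avoid_weight o' k) n x \<xi> = 1"
    unfolding weight_prod_def
    by (intro prod.neutral) (fastforce simp: avoid_weight_def tree_upto_def visits_def)
  with True show ?thesis by simp
next
  case False
  then have "weight_prod G (avoid_weight o' k) n x \<xi> = 0"
    unfolding weight_prod_def
    by (intro prod_zero finite_tree_upto) (auto simp: avoid_weight_def tree_upto_def visits_def)
  with False show ?thesis by simp
qed

lemma sets_avoid [measurable]:
  "{\<xi>. \<forall>v\<in>visits G o' x \<xi>. k \<le> length v \<longrightarrow> n < length v} \<in> sets (brw_space p)"
proof -
  have "Measurable.pred (brw_space p) (\<lambda>\<xi>. \<forall>v. in_tree \<xi> v \<and> brw_pos G x \<xi> v = o' \<longrightarrow> k \<le> length v \<longrightarrow> n < length v)"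
    by measurable
  then show ?thesis by (simp add: visits_def pred_def Ball_def)
qed

lemma weight_val_avoid:
  assumes "\<And>x. finite (nbrs G x)" "\<And>x. nbrs G x \<noteq> {}"
  shows "weight_val G p n (avoid_weight o' k) x =
    emeasure (brw_space p) {\<xi>. \<forall>v\<in>visits G o' x \<xi>. k \<le> length v \<longrightarrow> n < length v}"
  using nn_integral_weight_prod[OF assms, where \<phi>="avoid_weight o' k" and n=n and x=x and p=p]
  by (simp add: weight_prod_avoid)

text \<open>For some \<open>k\<close> there is no visit in generations \<open>k\<close> to
  \<open>n\<close>, whatever \<open>n\<close>; these events decrease in \<open>n\<close>, and their
  intersections increase in \<open>k\<close>.\<close>

lemma fin_prob_eq_limit:
  assumes "\<And>x. finite (nbrs G x)" "\<And>x. nbrs G x \<noteq> {}"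
  shows "fin_prob G p o' x = (SUP k. INF n. weight_val G p n (avoid_weight o' k) x)"
proof -
  interpret prob_space "brw_space p" by (rule prob_space_brw)
  define A where "A k n = {\<xi>. \<forall>v\<in>visits G o' x \<xi>. k \<le> length v \<longrightarrow> n < length v}" for k n
  have m: "A k n \<in> sets (brw_space p)" for k n by (simp add: A_def)
  have "(SUP k. INF n. weight_val G p n (avoid_weight o' k) x) = (SUP k. INF n. emeasure (brw_space p) (A k n))"
    by (simp add: weight_val_avoid[OF assms] A_def)
  also have "\<dots> = (SUP k. emeasure (brw_space p) (\<Inter>n. A k n))"
  proof (intro SUP_cong refl INF_emeasure_decseq)
    show "decseq (A k)" for k by (auto simp: decseq_def A_def)
  qed (use m in auto)
  also have "\<dots> = emeasure (brw_space p) (\<Union>k. \<Inter>n. A k n)"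
  proof (rule SUP_emeasure_incseq)
    show "incseq (\<lambda>k. \<Inter>n. A k n)" by (fastforce simp: incseq_def A_def)
  qed (use m in auto)
  also have "(\<Union>k. \<Inter>n. A k n) = {\<xi>. finite (visits G o' x \<xi>)}"
    unfolding finite_visits_iff A_def
    by (auto simp: not_less) (meson not_less less_irrefl)+
  finally show ?thesis by (simp add: fin_prob_def)
qed

lemma brw_alpha_eq: "ennreal (brw_alpha G p x) = 1 - fin_prob G p x x"
proof -
  interpret prob_space "brw_space p" by (rule prob_space_brw)
  have "{\<xi> \<in> space (brw_space p). infinite {v. in_tree \<xi> v \<and> brw_pos G x \<xi> v = x}} =
      space (brw_space p) - {\<xi>. finite (visits G x x \<xi>)}"
    by (auto simp: visits_def)
  then show ?thesis
    using prob_compl[of "{\<xi>. finite (visits G x x \<xi>)}"]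
    by (simp add: brw_alpha_def emeasure_eq_measure fin_prob_def ennreal_minus)
      (simp add: ennreal_minus[symmetric])
qed

lemma offspring_gf_mono: "s \<le> t \<Longrightarrow> offspring_gf p s \<le> offspring_gf p t"
  unfolding offspring_gf_def by (intro nn_integral_mono power_mono) auto

lemma srw_op_mono: "(\<And>z. v z \<le> w z) \<Longrightarrow> srw_op G v x \<le> srw_op G w x"
  unfolding srw_op_def by (intro divide_right_mono_ennreal suminf_le) auto

lemma weight_val_mono:
  "(\<And>l z. \<phi> l z \<le> \<psi> l z) \<Longrightarrow> weight_val G p n \<phi> x \<le> weight_val G p n \<psi> x"
  by (induction n arbitrary: \<phi> \<psi> x) (auto intro!: mult_mono offspring_gf_mono srw_op_mono)

section \<open>The offspring generating function\<close>

definition gfR :: "nat pmf \<Rightarrow> real \<Rightarrow> real" where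
  "gfR p s = (\<integral>k. s ^ k \<partial>measure_pmf p)"

text \<open>Probability that some child is marked when each is marked independently with probability
  \<open>t\<close>.\<close>

definition surv :: "nat pmf \<Rightarrow> real \<Rightarrow> real" where
  "surv p t = 1 - gfR p (1 - t)"

lemma integrable_power_pmf: "0 \<le> s \<Longrightarrow> s \<le> 1 \<Longrightarrow> integrable (measure_pmf p) (\<lambda>k::nat. (s::real) ^ k)"
  by (rule measure_pmf.integrable_const_bound[where B=1]) (auto intro: power_le_one)

lemma offspring_gf_ennreal: "0 \<le> s \<Longrightarrow> s \<le> 1 \<Longrightarrow> offspring_gf p (ennreal s) = ennreal (gfR p s)"
  unfolding offspring_gf_def gfR_def
  by (subst nn_integral_eq_integral[symmetric])
     (auto simp: integrable_power_pmf ennreal_power intro!: nn_integral_cong)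

lemma gfR_nonneg: "0 \<le> s \<Longrightarrow> 0 \<le> gfR p s"
  unfolding gfR_def by (rule Bochner_Integration.integral_nonneg) auto

lemma gfR_mono: "0 \<le> s \<Longrightarrow> s \<le> t \<Longrightarrow> t \<le> 1 \<Longrightarrow> gfR p s \<le> gfR p t"
  unfolding gfR_def by (intro integral_mono integrable_power_pmf power_mono) auto

lemma surv_mono: "0 \<le> s \<Longrightarrow> s \<le> t \<Longrightarrow> t \<le> 1 \<Longrightarrow> surv p s \<le> surv p t"
  unfolding surv_def using gfR_mono[of "1 - t" "1 - s" p] by auto

lemma surv_eq: "0 \<le> t \<Longrightarrow> t \<le> 1 \<Longrightarrow> surv p t = (\<integral>k. 1 - (1 - t) ^ k \<partial>measure_pmf p)"
  unfolding surv_def gfR_def by (subst Bochner_Integration.integral_diff) (auto intro: integrable_power_pmf)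

lemma surv_bounds: "0 \<le> t \<Longrightarrow> t \<le> 1 \<Longrightarrow> 0 \<le> surv p t \<and> surv p t \<le> 1"
  using surv_eq[of t p] gfR_nonneg[of "1 - t" p]
  by (auto simp: surv_def intro!: Bochner_Integration.integral_nonneg power_le_one)

lemma gfR_le:
  assumes "pmf p 0 = 0" "0 \<le> s" "s \<le> 1"
  shows "gfR p s \<le> s"
proof -
  have "gfR p s \<le> (\<integral>k. s \<partial>measure_pmf p)"
    unfolding gfR_def
  proof (rule integral_mono_AE[OF integrable_power_pmf])
    show "AE k in measure_pmf p. s ^ k \<le> s"
      unfolding AE_measure_pmf_iff
    proof
      fix k assume "k \<in> set_pmf p"
      then have "k \<noteq> 0" using assms(1) by (metis pmf_eq_0_set_pmf)
      then show "s ^ k \<le> s" using power_decreasing[of 1 k s] assms by simp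
    qed
  qed (use assms in auto)
  then show ?thesis by simp
qed

lemma exists_two_offspring:
  assumes "pmf p 0 = 0" "pmf p 1 < 1"
  obtains k :: nat where "k \<ge> 2" "k \<in> set_pmf p"
proof -
  have "\<not> set_pmf p \<subseteq> {1}"
  proof
    assume "set_pmf p \<subseteq> {1}"
    then have "p = return_pmf 1" by (simp add: set_pmf_subset_singleton)
    then show False using assms by simp
  qed
  then obtain k where k: "k \<in> set_pmf p" "k \<noteq> 1" by auto
  moreover have "k \<noteq> 0" using assms(1) k by (metis pmf_eq_0_set_pmf)
  ultimately show ?thesis using that[of k] by auto
qed

lemma integral_pmf_strict_mono:
  fixes f g :: "nat \<Rightarrow> real"
  assumes "integrable (measure_pmf p) f" "integrable (measure_pmf p) g"
    and le: "\<And>k. k \<in> set_pmf p \<Longrightarrow> f k \<le> g k" and k: "k \<in> set_pmf p" "f k < g k"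
  shows "(\<integral>k. f k \<partial>measure_pmf p) < (\<integral>k. g k \<partial>measure_pmf p)"
proof -
  have "(\<integral>k. f k \<partial>measure_pmf p) \<le> (\<integral>k. g k \<partial>measure_pmf p)"
    using assms by (intro integral_mono_AE) (auto simp: AE_measure_pmf_iff)
  moreover have "(\<integral>k. g k - f k \<partial>measure_pmf p) \<noteq> 0"
  proof
    assume "(\<integral>k. g k - f k \<partial>measure_pmf p) = 0"
    then have "AE k in measure_pmf p. g k - f k = 0"
      using assms by (subst (asm) integral_nonneg_eq_0_iff_AE) (auto simp: AE_measure_pmf_iff)
    then show False using k by (auto simp: AE_measure_pmf_iff)
  qed
  ultimately show ?thesis using assms by simp
qed

text \<open>Some offspring number \<open>k\<close> is at least 2, and there
  \<open>s ^ k < s\<close>. This leaves 0 and 1 as the only possible fixed points in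
  \<open>[0, 1]\<close>.\<close>

lemma gfR_less:
  assumes "pmf p 0 = 0" "pmf p 1 < 1" "0 < s" "s < 1"
  shows "gfR p s < s"
proof -
  obtain k where k: "k \<ge> 2" "k \<in> set_pmf p" using exists_two_offspring[OF assms(1,2)] .
  have "gfR p s < (\<integral>k. s \<partial>measure_pmf p)"
    unfolding gfR_def
  proof (rule integral_pmf_strict_mono[OF integrable_power_pmf _ _ k(2)])
    show "s ^ k < s" using k power_strict_decreasing[of 1 k s] assms by simp
    fix j assume "j \<in> set_pmf p"
    then have "j \<noteq> 0" using assms(1) by (metis pmf_eq_0_set_pmf)
    then show "s ^ j \<le> s" using power_decreasing[of 1 j s] assms by simp
  qed (use assms in auto)
  then show ?thesis by simp
qed

lemma gfR_eq_0: 
  assumes "0 \<le> s" "s \<le> 1" "gfR p s = 0"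
  shows "s = 0"
proof (rule ccontr)
  assume "s \<noteq> 0"
  obtain k where k: "k \<in> set_pmf p" using set_pmf_not_empty[of p] by auto
  have "(\<integral>k. 0 \<partial>measure_pmf p) < gfR p s"
    unfolding gfR_def
    by (rule integral_pmf_strict_mono[OF _ integrable_power_pmf _ k]) (use assms \<open>s \<noteq> 0\<close> in auto)
  then show False using assms by simp
qed

lemma integrable_real_pmf:
  assumes "offspring_mean p \<le> ennreal m"
  shows "integrable (measure_pmf p) real" "(\<integral>k. real k \<partial>measure_pmf p) \<le> max m 0"
proof -
  have *: "(\<integral>\<^sup>+k. ennreal (real k) \<partial>measure_pmf p) \<le> ennreal m"
    using assms by (simp add: offspring_mean_def)
  show int: "integrable (measure_pmf p) real"
    by (rule integrableI_nonneg) (use * in \<open>auto intro: le_less_trans\<close>)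
  show "(\<integral>k. real k \<partial>measure_pmf p) \<le> max m 0"
    using * by (subst (asm) nn_integral_eq_integral[OF int]) (auto simp: ennreal_le_iff2)
qed

lemma surv_le:
  assumes "offspring_mean p \<le> ennreal m" "0 \<le> m" "0 \<le> t" "t \<le> 1"
  shows "surv p t \<le> m * t"
proof -
  have "surv p t \<le> (\<integral>k. real k * t \<partial>measure_pmf p)"
    unfolding surv_eq[OF assms(3,4)]
  proof (rule integral_mono)
    show "1 - (1 - t) ^ k \<le> real k * t" for k
      using Bernoulli_inequality[of "- t" k] assms by simp
  qed (use assms integrable_real_pmf in \<open>auto intro!: integrable_power_pmf\<close>)
  also have "\<dots> \<le> m * t"
    using integrable_real_pmf[OF assms(1)] assms(2,3) by (auto intro: mult_right_mono)
  finally show ?thesis .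
qed

lemma surv_less:
  assumes "offspring_mean p \<le> ennreal m" "0 \<le> m" "0 < t" "t \<le> 1" "pmf p 0 = 0" "pmf p 1 < 1"
  shows "surv p t < m * t"
proof -
  obtain k where k: "k \<ge> 2" "k \<in> set_pmf p" using exists_two_offspring[OF assms(5,6)] .
  have "surv p t = (\<integral>k. 1 - (1 - t) ^ k \<partial>measure_pmf p)"
    using assms by (intro surv_eq) auto
  also have "\<dots> < (\<integral>k. real k * t \<partial>measure_pmf p)"
  proof (rule integral_pmf_strict_mono[OF _ _ _ k(2)])
    show "1 - (1 - t) ^ k \<le> real k * t" for k
      using Bernoulli_inequality[of "- t" k] assms by simp
    \<comment> \<open>Applying Bernoulli's inequality to only \<open>k - 1\<close> of the
      \<open>k\<close> factors leaves the surplus \<open>j * t\<^sup>2\<close>, positive since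
      \<open>k \<ge> 2\<close>.\<close>
    obtain j where j: "k = Suc j" "j \<ge> 1" using k by (cases k) auto
    have "(1 - t) * (1 - real j * t) \<le> (1 - t) * (1 - t) ^ j"
      using Bernoulli_inequality[of "- t" j] assms by (intro mult_left_mono) auto
    moreover have "(1 - t) * (1 - real j * t) = 1 - real k * t + real j * t\<^sup>2"
      by (simp add: j algebra_simps power2_eq_square)
    moreover have "real j * t\<^sup>2 > 0" using j assms by auto
    ultimately show "1 - (1 - t) ^ k < real k * t" using j(1) by simp
  qed (use assms integrable_real_pmf[OF assms(1)] in \<open>auto intro!: integrable_power_pmf\<close>)
  also have "\<dots> \<le> m * t"
    using integrable_real_pmf[OF assms(1)] assms(2,3) by (auto intro: mult_right_mono)
  finally show ?thesis .
qed

text \<open>Inclusion-exclusion to second order, with the binomial coefficient replaced by the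
  cruder square.\<close>

lemma one_minus_power_ge:
  fixes t :: real
  assumes "0 \<le> t" "t \<le> 1"
  shows "real k * t - (real k)\<^sup>2 * t\<^sup>2 \<le> 1 - (1 - t) ^ k"
proof (induction k)
  case (Suc k)
  have "(1 - t) * (1 - t) ^ k \<le> (1 - t) * (1 - real k * t + (real k)\<^sup>2 * t\<^sup>2)"
    using Suc assms by (intro mult_left_mono) auto
  also have "\<dots> = 1 - real (Suc k) * t + ((real k)\<^sup>2 + real k) * t\<^sup>2 - (real k)\<^sup>2 * t ^ 3"
    by (simp add: algebra_simps power2_eq_square power3_eq_cube)
  also have "\<dots> \<le> 1 - real (Suc k) * t + (real (Suc k))\<^sup>2 * t\<^sup>2"
  proof -
    have "((real k)\<^sup>2 + real k) * t\<^sup>2 \<le> (real (Suc k))\<^sup>2 * t\<^sup>2"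
      by (intro mult_right_mono) (auto simp: power2_eq_square algebra_simps)
    moreover have "0 \<le> (real k)\<^sup>2 * t ^ 3" using assms by simp
    ultimately show ?thesis by linarith
  qed
  finally show ?case by simp
qed simp

text \<open>The mean truncated at some \<open>K\<close> already exceeds \<open>m\<close>, and the
  truncation has a finite second moment, so the second-order error is negligible near 0. This covers
  an infinite mean.\<close>

lemma surv_ge:
  assumes "ennreal m < offspring_mean p" "0 \<le> m"
  obtains e where "0 < e" "e \<le> 1" "\<And>t. 0 \<le> t \<Longrightarrow> t \<le> e \<Longrightarrow> m * t \<le> surv p t"
proof -
  have "offspring_mean p = (\<Sum>k. ennreal (pmf p k) * ennreal (real k))"
    by (simp add: offspring_mean_def nn_integral_measure_pmf nn_integral_count_space_nat)
  also have "\<dots> = (\<Sum>k. ennreal (pmf p k * real k))" by (simp add: ennreal_mult)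
  also have "\<dots> = (SUP K. \<Sum>k<K. ennreal (pmf p k * real k))" by (rule suminf_eq_SUP)
  also have "\<dots> = (SUP K. ennreal (\<Sum>k<K. pmf p k * real k))" by simp
  finally obtain K where "ennreal m < ennreal (\<Sum>k<K. pmf p k * real k)"
    using assms(1) by (auto simp: less_SUP_iff)
  then have K: "m < (\<Sum>k<K. pmf p k * real k)" using assms(2) by (simp add: ennreal_less_iff)
  define A where "A = (\<Sum>k<K. pmf p k * real k)"
  define B where "B = (\<Sum>k<K. pmf p k * (real k)\<^sup>2)"
  have B: "B \<ge> 0" unfolding B_def by (intro sum_nonneg) auto
  \<comment> \<open>Chosen so that \<open>A - e * B\<close> is still at least \<open>m\<close>; the
    1 in the denominator guards against \<open>B = 0\<close>.\<close>
  define e where "e = min 1 ((A - m) / (B + 1))"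
  have e: "0 < e" "e \<le> 1"
    using B K by (auto simp: e_def A_def)
  have "e \<le> (A - m) / (B + 1)" by (simp add: e_def)
  then have eAB: "e * (B + 1) \<le> A - m" using B by (simp add: pos_le_divide_eq)
  have "m * t \<le> surv p t" if t: "0 \<le> t" "t \<le> e" for t
  proof -
    have t1: "t \<le> 1" using t e by simp
    have "t * B \<le> e * (B + 1)" using t B e by (intro mult_mono) auto
    then have "m \<le> A - t * B" using eAB by linarith
    then have "m * t \<le> t * (A - t * B)" using mult_left_mono[of m "A - t * B" t] t by (simp add: mult.commute)
    also have "\<dots> = (\<Sum>k<K. pmf p k * (real k * t - (real k)\<^sup>2 * t\<^sup>2))"
      by (simp add: A_def B_def sum_distrib_left sum_subtractf algebra_simps power2_eq_square)
    also have "\<dots> \<le> (\<Sum>k<K. pmf p k * (1 - (1 - t) ^ k))"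
      using t t1 by (intro sum_mono mult_left_mono one_minus_power_ge) auto
    also have "\<dots> = (\<integral>k. (1 - (1 - t) ^ k) * indicator {..<K} k \<partial>measure_pmf p)"
      by (subst integral_measure_pmf_real[of "{..<K}"]) (auto simp: mult.commute indicator_def)
    also have "\<dots> \<le> (\<integral>k. 1 - (1 - t) ^ k \<partial>measure_pmf p)"
    proof (rule integral_mono)
      show "integrable (measure_pmf p) (\<lambda>k. 1 - (1 - t) ^ k)"
        using t t1 by (auto intro!: integrable_power_pmf)
      then show "integrable (measure_pmf p) (\<lambda>k. (1 - (1 - t) ^ k) * indicator {..<K} k)"
        by (rule integrable_real_mult_indicator[rotated]) auto
    qed (use t t1 in \<open>auto simp: indicator_def power_le_one\<close>)
    also have "\<dots> = surv p t" using t t1 by (simp add: surv_eq)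
    finally show ?thesis .
  qed
  then show ?thesis using that e by blast
qed

section \<open>Finite-visit probabilities on a fixed graph\<close>

definition srw_opR :: "graph \<Rightarrow> (nat \<Rightarrow> real) \<Rightarrow> nat \<Rightarrow> real" where
  "srw_opR G w x = (\<Sum>z\<in>nbrs G x. srw_p G x z * w z)"

locale bounded_graph =
  fixes G :: graph and D :: nat
  assumes good: "good_graph G D"
begin

lemma edge_sym: "G (x, y) \<longleftrightarrow> G (y, x)"
  using good by (auto simp: good_graph_def)

lemma nbrs_sym: "y \<in> nbrs G x \<longleftrightarrow> x \<in> nbrs G y"
  using edge_sym by (auto simp: nbrs_def)

lemma not_self_nbr: "x \<notin> nbrs G x"
  using good by (auto simp: good_graph_def nbrs_def)

lemma finite_nbrs [simp]: "finite (nbrs G x)"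
  using good by (auto simp: good_graph_def)

lemma deg_le: "deg G x \<le> D"
  using good by (auto simp: good_graph_def)

lemma connected: "(x, y) \<in> {(a, b). G (a, b)}\<^sup>*"
  using good unfolding good_graph_def by blast

lemma nbrs_nonempty [simp]: "nbrs G x \<noteq> {}"
proof -
  \<comment> \<open>Any second vertex would do: a path leading to it must leave
    \<open>x\<close>.\<close>
  have "(x, Suc x) \<in> {(a, b). G (a, b)}\<^sup>*" by (rule connected)
  then show ?thesis
    by (cases rule: converse_rtranclE) (auto simp: nbrs_def)
qed

lemma deg_pos [simp]: "deg G x > 0"
  by (simp add: deg_def card_gt_0_iff)

lemma nbrs_induct:
  assumes "Q o'" "\<And>x y. Q x \<Longrightarrow> y \<in> nbrs G x \<Longrightarrow> Q y"
  shows "Q z"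
  using connected[of o' z] by (induction rule: rtrancl_induct) (auto intro: assms simp: nbrs_def)

lemma srw_p_nbr: "z \<in> nbrs G x \<Longrightarrow> srw_p G x z = 1 / real (deg G x)"
  by (simp add: srw_p_def nbrs_def)

lemma srw_opR_eq: "srw_opR G w x = (\<Sum>z\<in>nbrs G x. w z) / real (deg G x)"
  by (simp add: srw_opR_def srw_p_nbr sum_divide_distrib)

lemma srw_op_eq: "srw_op G w x = (\<Sum>z\<in>nbrs G x. w z) * ennreal (1 / real (deg G x))"
proof -
  have "(\<Sum>z. if G (x, z) then w z else 0) = (\<Sum>z\<in>nbrs G x. w z)"
    by (subst suminf_finite[of "nbrs G x"])
      (auto simp: nbrs_def finite_nbrs[unfolded nbrs_def] intro: sum.cong)
  moreover have "(\<Sum>z. if G (x, z) then 1 else 0) = ennreal (real (deg G x))"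
    by (subst suminf_finite[of "nbrs G x"])
      (auto simp: nbrs_def finite_nbrs[unfolded nbrs_def] deg_def ennreal_of_nat_eq_real_of_nat intro: sum.cong)
  moreover have "inverse (ennreal (real (deg G x))) = ennreal (1 / real (deg G x))"
    by (subst inverse_ennreal) (auto simp: inverse_eq_divide)
  ultimately show ?thesis by (simp add: srw_op_def divide_ennreal_def)
qed

lemma srw_op_ennreal:
  assumes "\<And>z. 0 \<le> w z"
  shows "srw_op G (\<lambda>z. ennreal (w z)) x = ennreal (srw_opR G w x)"
  using assms by (simp add: srw_op_eq srw_opR_eq ennreal_mult[symmetric] sum_nonneg)

lemma srw_opR_mono: "(\<And>z. z \<in> nbrs G x \<Longrightarrow> v z \<le> w z) \<Longrightarrow> srw_opR G v x \<le> srw_opR G w x"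
  unfolding srw_opR_eq by (intro divide_right_mono sum_mono) auto

lemma srw_opR_const: "srw_opR G (\<lambda>_. c) x = c"
  unfolding srw_opR_eq using deg_pos[of x] by (simp add: deg_def[symmetric])

lemma srw_opR_bounds:
  assumes "\<And>z. 0 \<le> w z" "\<And>z. w z \<le> 1"
  shows "0 \<le> srw_opR G w x" "srw_opR G w x \<le> 1"
  using srw_opR_mono[of x "\<lambda>_. 0" w] srw_opR_mono[of x w "\<lambda>_. 1"] assms
  by (auto simp: srw_opR_const)

lemma srw_opR_cmult: "srw_opR G (\<lambda>z. c * w z) x = c * srw_opR G w x"
  by (simp add: srw_opR_eq sum_distrib_left)

lemma srw_opR_sum: "srw_opR G (\<lambda>z. \<Sum>i\<in>I. w i z) x = (\<Sum>i\<in>I. srw_opR G (w i) x)"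
  unfolding srw_opR_eq by (subst sum.swap) (simp add: sum_divide_distrib)

lemma srw_opR_one_minus: "srw_opR G (\<lambda>z. 1 - w z) x = 1 - srw_opR G w x"
  using srw_opR_const[of 1 x] by (simp add: srw_opR_eq sum_subtractf diff_divide_distrib)

lemma srw_op_le_1: "(\<And>z. w z \<le> 1) \<Longrightarrow> srw_op G w x \<le> 1"
  using srw_op_mono[of w "\<lambda>_. ennreal 1" G x] srw_op_ennreal[of "\<lambda>_. 1" x]
  by (simp add: srw_opR_const)

lemma srw_opR_eq_0_D:
  assumes "\<And>z. 0 \<le> w z" "srw_opR G w x = 0" "z \<in> nbrs G x"
  shows "w z = 0"
  using assms deg_pos[of x] by (simp add: srw_opR_eq sum_nonneg_eq_0_iff)

lemma srw_pn_Suc: "srw_pn G (Suc n) x y = srw_opR G (\<lambda>z. srw_pn G n z y) x"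
  by (simp add: srw_opR_def)

lemma srw_pn_bounds: "0 \<le> srw_pn G n x y" "srw_pn G n x y \<le> 1"
proof (induction n arbitrary: x)
  case (Suc n)
  { case 1 show ?case unfolding srw_pn_Suc by (rule srw_opR_bounds) (auto intro: Suc)
  next case 2 show ?case unfolding srw_pn_Suc by (rule srw_opR_bounds) (auto intro: Suc) }
qed auto

end

section \<open>The finite-visit function \<open>q\<close>, its propagation along edges and its
  independence of the target\<close>

locale brw = bounded_graph +
  fixes p :: "nat pmf"
  assumes p0: "pmf p 0 = 0" and p1: "pmf p 1 < 1"
begin

lemmas fin_prob_branching' = fin_prob_branching[OF finite_nbrs nbrs_nonempty]

lemma fin_prob_le_1: "fin_prob G p o' x \<le> 1"
proof -
  interpret prob_space "brw_space p" by (rule prob_space_brw)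
  show ?thesis unfolding fin_prob_def by (rule emeasure_le_1)
qed

definition q :: "nat \<Rightarrow> nat \<Rightarrow> real" where
  "q o' x = enn2real (fin_prob G p o' x)"

lemma ennreal_q: "fin_prob G p o' x = ennreal (q o' x)"
  unfolding q_def using fin_prob_le_1[of o' x]
  by (metis ennreal_enn2real ennreal_one_less_top order_le_less_trans)

lemma q_bounds: "0 \<le> q o' x" "q o' x \<le> 1"
  using fin_prob_le_1[of o' x] by (auto simp: q_def intro: enn2real_leI)

lemma q_branching: "q o' x = gfR p (srw_opR G (q o') x)"
proof -
  have "ennreal (q o' x) = ennreal (gfR p (srw_opR G (q o') x))"
    using fin_prob_branching'[of p o' x]
    by (simp add: ennreal_q[abs_def] srw_op_ennreal q_bounds offspring_gf_ennreal srw_opR_bounds)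
  then show ?thesis
    by (simp add: q_bounds gfR_nonneg srw_opR_bounds)
qed

lemma brw_alpha_q: "brw_alpha G p x = 1 - q x x"
proof -
  have "ennreal (brw_alpha G p x) = ennreal (1 - q x x)"
    using brw_alpha_eq[of G p x] by (simp add: ennreal_q ennreal_minus[symmetric] q_bounds del: ennreal_1 flip: ennreal_1)
  moreover have "0 \<le> brw_alpha G p x" by (simp add: brw_alpha_def)
  ultimately show ?thesis using q_bounds by simp
qed

text \<open>The generating function vanishes only at 0, and a vanishing average of nonnegative
  values vanishes termwise, so the value 0 spreads along edges.\<close>

lemma q_eq_0_everywhere:
  assumes "q o' x = 0" shows "q o' z = 0"
proof (rule nbrs_induct[of "\<lambda>z. q o' z = 0", OF assms])
  fix x y assume "q o' x = 0" "y \<in> nbrs G x"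
  then have "srw_opR G (q o') x = 0"
    using q_branching[of o' x] gfR_eq_0[of "srw_opR G (q o') x" p] q_bounds srw_opR_bounds by auto
  then show "q o' y = 0" using srw_opR_eq_0_D[of "q o'" x y] q_bounds \<open>y \<in> _\<close> by auto
qed

text \<open>Since \<open>g s \<le> s\<close>, the value 1 forces \<open>P q \<ge> 1\<close>, hence
  the value 1 at every neighbour.\<close>

lemma q_eq_1_everywhere:
  assumes "q o' x = 1" shows "q o' z = 1"
proof (rule nbrs_induct[of "\<lambda>z. q o' z = 1", OF assms])
  fix x y assume "q o' x = 1" "y \<in> nbrs G x"
  then have "1 \<le> srw_opR G (q o') x"
    using q_branching[of o' x] gfR_le[OF p0, of "srw_opR G (q o') x"] q_bounds srw_opR_bounds[of "q o'" x] by auto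
  then have "srw_opR G (\<lambda>z. 1 - q o' z) x = 0"
    using srw_opR_bounds[of "q o'" x] q_bounds by (simp add: srw_opR_one_minus)
  then show "q o' y = 1" using srw_opR_eq_0_D[of "\<lambda>z. 1 - q o' z" x y] q_bounds \<open>y \<in> _\<close> by auto
qed

text \<open>The reward \<open>c > 1\<close> for each visit to \<open>x\<close> is compensated by the chance \<open>1 / deg x\<close> of stepping
  to the forbidden neighbour \<open>y\<close>, so the expected product stays at most 1. Hence \<open>x\<close> is almost surely
  visited only finitely often once visits to \<open>y\<close> have stopped.\<close>

definition pass_weight :: "nat \<Rightarrow> nat \<Rightarrow> ennreal \<Rightarrow> nat \<Rightarrow> nat \<Rightarrow> nat \<Rightarrow> nat \<Rightarrow> ennreal" where
  "pass_weight x y c k n l w =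
     (if l < k then 1 else if w = y then 0 else if w = x \<and> l < n then c else 1)"

lemma offspring_gf_le: "s \<le> 1 \<Longrightarrow> offspring_gf p s \<le> s"
proof -
  assume s: "s \<le> 1"
  then obtain r where r: "s = ennreal r" "0 \<le> r" "r \<le> 1"
    by (cases s) (auto simp: ennreal_le_1 top_unique)
  then show ?thesis using gfR_le[OF p0, of r] by (simp add: offspring_gf_ennreal)
qed

lemma weight_val_pass_le_1:
  assumes y: "y \<in> nbrs G x" and c: "c = ennreal (1 + 1 / deg G x)"
  shows "weight_val G p n (pass_weight x y c k n) z \<le> 1"
proof (induction n arbitrary: k z)
  case 0
  \<comment> \<open>The last generation earns no reward, because of \<open>l < n\<close>; this lets
    the induction start with a bound of 1.\<close>
  then show ?case by (simp add: pass_weight_def)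
next
  case (Suc n)
  \<comment> \<open>Truncated subtraction is intended: once \<open>k\<close> is 0, the condition is
    in force in every generation.\<close>
  have shift: "(\<lambda>l. pass_weight x y c k (Suc n) (Suc l)) = pass_weight x y c (k - 1) n"
    by (auto simp: pass_weight_def fun_eq_iff)
  let ?w = "weight_val G p n (pass_weight x y c (k - 1) n)"
  have le1: "srw_op G ?w z \<le> 1" by (rule srw_op_le_1) (rule Suc)
  then have gle: "offspring_gf p (srw_op G ?w z) \<le> srw_op G ?w z" by (rule offspring_gf_le)
  show ?case
  proof (cases "k = 0 \<and> z = x \<and> x \<noteq> y")
    case True
    have wy: "?w y = 0" by (cases n) (auto simp: pass_weight_def True)
    have "srw_op G ?w z \<le> srw_op G (\<lambda>u. ennreal (if u = y then 0 else 1)) z"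
      using Suc wy by (intro srw_op_mono) auto
    also have "\<dots> = ennreal (srw_opR G (\<lambda>u. if u = y then 0 else 1) z)"
      by (rule srw_op_ennreal) auto
    also have "srw_opR G (\<lambda>u. if u = y then 0 else 1) z = srw_opR G (\<lambda>u. 1 - (if u = y then 1 else 0)) z"
      by (intro arg_cong[where f="\<lambda>f. srw_opR G f z"]) auto
    also have "\<dots> = 1 - 1 / deg G x"
      unfolding srw_opR_one_minus using True y by (simp add: srw_opR_eq)
    finally have "srw_op G ?w z \<le> ennreal (1 - 1 / deg G x)" .
    with gle have "offspring_gf p (srw_op G ?w z) \<le> ennreal (1 - 1 / deg G x)"
      by (rule order_trans)
    then have "c * offspring_gf p (srw_op G ?w z) \<le> c * ennreal (1 - 1 / deg G x)"
      by (rule mult_left_mono) simp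
    also have "\<dots> = ennreal (1 + 1 / deg G x) * ennreal (1 - 1 / deg G x)" by (simp only: c)
    also have "\<dots> = ennreal ((1 + 1 / deg G x) * (1 - 1 / deg G x))"
      by (rule ennreal_mult[symmetric]) (auto simp: Suc_le_eq)
    \<comment> \<open>\<open>(1 + a) * (1 - a) \<le> 1\<close> is the origin of the reward
      \<open>1 + 1 / deg G x\<close>.\<close>
    also have "\<dots> \<le> 1"
      by (simp add: algebra_simps ennreal_le_1)
    finally have "c * offspring_gf p (srw_op G ?w z) \<le> 1" .
    moreover have "pass_weight x y c k (Suc n) 0 z = c" using True by (simp add: pass_weight_def)
    ultimately show ?thesis by (simp only: weight_val.simps shift)
  next
    case False
    then have "pass_weight x y c k (Suc n) 0 z \<le> 1"
      by (auto simp: pass_weight_def)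
    then have "pass_weight x y c k (Suc n) 0 z * offspring_gf p (srw_op G ?w z) \<le> 1 * 1"
      using gle le1 by (intro mult_mono) auto
    then show ?thesis by (simp add: shift)
  qed
qed

end

lemma prod_ge_1_ennreal:
  fixes f :: "'a \<Rightarrow> ennreal"
  assumes "\<And>a. a \<in> A \<Longrightarrow> 1 \<le> f a"
  shows "1 \<le> prod f A"
  using assms
proof (induction A rule: infinite_finite_induct)
  case (insert a A)
  then have "1 * 1 \<le> f a * prod f A" by (intro mult_mono) auto
  with insert show ?case by simp
qed auto

context brw
begin

text \<open>Fatou's lemma: on this event the weight products tend to infinity with \<open>n\<close>,
  while their means are at most 1.\<close>

lemma pass_null:
  assumes y: "y \<in> nbrs G x"
  shows "{\<xi>. infinite (visits G x z \<xi>) \<and> (\<forall>v\<in>visits G y z \<xi>. length v < k)} \<in> null_sets (brw_space p)"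
proof -
  interpret M: prob_space "brw_space p" by (rule prob_space_brw)
  define c where "c = ennreal (1 + 1 / deg G x)"
  define B where "B = {\<xi>. infinite (visits G x z \<xi>) \<and> (\<forall>v\<in>visits G y z \<xi>. length v < k)}"
  let ?W = "\<lambda>n. weight_prod G (pass_weight x y c k n) n z"
  have "ennreal 1 < c" unfolding c_def by (subst ennreal_less_iff) auto
  then have c1: "1 < c" by simp
  have [measurable]: "B \<in> sets (brw_space p)"
  proof -
    have "{\<xi>. \<forall>v. in_tree \<xi> v \<and> brw_pos G z \<xi> v = y \<longrightarrow> length v < k} \<in> sets (brw_space p)"
      using measurable_sets[of "\<lambda>\<xi>. \<forall>v. in_tree \<xi> v \<and> brw_pos G z \<xi> v = y \<longrightarrow> length v < k" "brw_space p" "count_space UNIV" "{True}"]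
      by (simp add: vimage_def)
    moreover have "B = (space (brw_space p) - {\<xi>. finite (visits G x z \<xi>)}) \<inter>
       {\<xi>. \<forall>v. in_tree \<xi> v \<and> brw_pos G z \<xi> v = y \<longrightarrow> length v < k}"
      by (auto simp: B_def visits_def)
    ultimately show ?thesis by (simp only: sets.Int sets.Diff sets.top sets_finite_visits)
  qed
  have inf: "liminf (\<lambda>n. ?W n \<xi>) = \<infinity>" if "\<xi> \<in> B" for \<xi>
  proof -
    have "infinite (visits G x z \<xi> - tree_upto \<xi> k)" using that by (simp add: B_def)
    have "c ^ j \<le> liminf (\<lambda>n. ?W n \<xi>)" for j
    proof (rule Liminf_bounded)
      obtain S where S: "S \<subseteq> visits G x z \<xi> - tree_upto \<xi> k" "finite S" "card S = j"
        using infinite_arbitrarily_large[OF \<open>infinite (visits G x z \<xi> - tree_upto \<xi> k)\<close>] by blast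
      have "finite (length ` S)" using S(2) by simp
      then obtain N where "\<forall>l\<in>length ` S. l < N" unfolding finite_nat_set_iff_bounded ..
      then have N: "\<And>v. v \<in> S \<Longrightarrow> length v < N" by blast
      have "c ^ j \<le> ?W n \<xi>" if "n \<ge> N" for n
      proof -
        have fac: "pass_weight x y c k n (length v) (brw_pos G z \<xi> v) \<ge> 1" if "v \<in> tree_upto \<xi> n" for v
          using that \<open>\<xi> \<in> B\<close> c1 by (auto simp: pass_weight_def B_def visits_def tree_upto_def)
        have sub: "S \<subseteq> tree_upto \<xi> n"
        proof
          fix v assume "v \<in> S"
          then show "v \<in> tree_upto \<xi> n"
            using S(1) N[of v] that by (auto simp: visits_def tree_upto_def)
        qed
        have "c ^ j = (\<Prod>v\<in>S. pass_weight x y c k n (length v) (brw_pos G z \<xi> v))"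
        proof -
          have "pass_weight x y c k n (length v) (brw_pos G z \<xi> v) = c" if v: "v \<in> S" for v
          proof -
            have "length v < n" using N[OF v] \<open>n \<ge> N\<close> by simp
            moreover have "\<not> length v < k" "brw_pos G z \<xi> v = x"
              using S(1) v by (auto simp: visits_def tree_upto_def)
            ultimately show ?thesis using y not_self_nbr by (auto simp: pass_weight_def)
          qed
          then have "(\<Prod>v\<in>S. pass_weight x y c k n (length v) (brw_pos G z \<xi> v)) = (\<Prod>v\<in>S. c)"
            by (intro prod.cong refl)
          then show ?thesis using S(3) by simp
        qed
        also have "(\<Prod>v\<in>S. pass_weight x y c k n (length v) (brw_pos G z \<xi> v)) =
            (\<Prod>v\<in>S. pass_weight x y c k n (length v) (brw_pos G z \<xi> v)) * 1" by simp
        also have "\<dots> \<le> (\<Prod>v\<in>S. pass_weight x y c k n (length v) (brw_pos G z \<xi> v)) *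
            (\<Prod>v\<in>tree_upto \<xi> n - S. pass_weight x y c k n (length v) (brw_pos G z \<xi> v))"
          using fac by (intro mult_left_mono prod_ge_1_ennreal) auto
        also have "\<dots> = ?W n \<xi>"
          unfolding weight_prod_def
          by (subst prod.subset_diff[OF sub finite_tree_upto]) (rule mult.commute)
        finally show ?thesis .
      qed
      then show "\<forall>\<^sub>F n in sequentially. c ^ j \<le> ?W n \<xi>"
        by (auto simp: eventually_sequentially)
    qed
    moreover have "(SUP j. c ^ j) = \<infinity>"
    proof -
      show ?thesis
      unfolding infinity_ennreal_def
      proof (rule ennreal_SUP_eq_top)
        fix n :: nat
        obtain j where "real n < (1 + 1 / real (deg G x)) ^ j"
          using real_arch_pow[of "1 + 1 / real (deg G x)" "real n"] by auto
        moreover have "c ^ j = ennreal ((1 + 1 / real (deg G x)) ^ j)"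
          unfolding c_def by (rule ennreal_power) simp
        ultimately have "of_nat n \<le> c ^ j"
          unfolding ennreal_of_nat_eq_real_of_nat by (simp add: ennreal_leI)
        then show "\<exists>j\<in>UNIV. of_nat n \<le> c ^ j" by blast
      qed
    qed
    moreover have "(SUP j. c ^ j) \<le> liminf (\<lambda>n. ?W n \<xi>)" using calculation(1) by (rule SUP_least)
    ultimately have "\<infinity> \<le> liminf (\<lambda>n. ?W n \<xi>)" by (simp only:)
    then show ?thesis by (simp add: top_unique)
  qed
  have "\<infinity> * emeasure (brw_space p) B = (\<integral>\<^sup>+\<xi>. \<infinity> * indicator B \<xi> \<partial>brw_space p)"
    by (rule nn_integral_cmult_indicator[symmetric]) simp
  also have "\<dots> \<le> (\<integral>\<^sup>+\<xi>. liminf (\<lambda>n. ?W n \<xi>) \<partial>brw_space p)"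
    using inf by (intro nn_integral_mono) (auto simp: indicator_def)
  also have "\<dots> \<le> liminf (\<lambda>n. \<integral>\<^sup>+\<xi>. ?W n \<xi> \<partial>brw_space p)"
    by (rule nn_integral_liminf) simp
  also have "\<dots> \<le> liminf (\<lambda>n. 1)"
    by (intro Liminf_mono always_eventually allI)
      (simp add: nn_integral_weight_prod weight_val_pass_le_1[OF y c_def])
  finally have "\<infinity> * emeasure (brw_space p) B \<le> 1" by (simp add: Liminf_const)
  then have "emeasure (brw_space p) B = 0"
    by (cases "emeasure (brw_space p) B = 0") (auto simp: ennreal_top_mult top_unique)
  then show ?thesis unfolding B_def[symmetric] by (auto intro: null_setsI)
qed

text \<open>Finitely many visits to \<open>y\<close> all lie below some generation \<open>k\<close>,
  and a countable union of null events is null.\<close>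

lemma fin_prob_nbr_le:
  assumes y: "y \<in> nbrs G x"
  shows "fin_prob G p y z \<le> fin_prob G p x z"
proof -
  define N where "N = (\<Union>k. {\<xi>. infinite (visits G x z \<xi>) \<and> (\<forall>v\<in>visits G y z \<xi>. length v < k)})"
  have N: "N \<in> null_sets (brw_space p)" unfolding N_def by (intro null_sets_UN pass_null y)
  have "fin_prob G p y z \<le> emeasure (brw_space p) ({\<xi>. finite (visits G x z \<xi>)} \<union> N)"
    unfolding fin_prob_def
  proof (rule emeasure_mono)
    show "{\<xi>. finite (visits G y z \<xi>)} \<subseteq> {\<xi>. finite (visits G x z \<xi>)} \<union> N"
      unfolding N_def finite_visits_iff[of G y] by blast
  qed (use N in auto)
  also have "\<dots> = fin_prob G p x z"
    unfolding fin_prob_def by (rule emeasure_Un_null_set[OF _ N]) simp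
  finally show ?thesis .
qed

lemma q_target: "q x z = q y z"
proof (rule nbrs_induct[of "\<lambda>y. q x z = q y z" x])
  fix a b assume "q x z = q a z" "b \<in> nbrs G a"
  moreover have "a \<in> nbrs G b" using \<open>b \<in> _\<close> nbrs_sym by simp
  ultimately show "q x z = q b z"
    using fin_prob_nbr_le[of b a z] fin_prob_nbr_le[of a b z] by (simp add: q_def)
qed simp

section \<open>The supercritical case: returning has positive probability\<close>

lemma srw_opR_cmult_right: "srw_opR G (\<lambda>z. w z * c) x = srw_opR G w x * c"
  using srw_opR_cmult[of c w x] by (simp add: mult.commute)

lemma offspring_gf_one_minus:
  assumes "\<And>z. 0 \<le> e z" "\<And>z. e z \<le> 1"
  shows "offspring_gf p (srw_op G (\<lambda>z. ennreal (1 - e z)) x) = ennreal (1 - surv p (srw_opR G e x))"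
  using assms srw_opR_bounds[of e x]
  by (simp add: srw_op_ennreal srw_opR_one_minus offspring_gf_ennreal surv_def)

text \<open>Probability that some particle of generation exactly \<open>j\<close> is at
  \<open>o'\<close>, as \<open>weight_val_hit\<close> confirms.\<close>

fun hit :: "nat \<Rightarrow> nat \<Rightarrow> nat \<Rightarrow> real" where
  "hit o' 0 z = (if z = o' then 1 else 0)"
| "hit o' (Suc j) z = surv p (srw_opR G (hit o' j) z)"

lemma hit_bounds: "0 \<le> hit o' j z \<and> hit o' j z \<le> 1"
proof (induction j arbitrary: z)
  case (Suc j)
  then show ?case using surv_bounds srw_opR_bounds[of "hit o' j" z] by simp
qed simp

lemma weight_val_hit:
  "weight_val G p j (\<lambda>l z. if l = j \<and> z = o' then 0 else 1) z = ennreal (1 - hit o' j z)"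
proof (induction j arbitrary: z)
  case (Suc j)
  then have "weight_val G p j (\<lambda>l z. if l = j \<and> z = o' then 0 else 1) = (\<lambda>z. ennreal (1 - hit o' j z))"
    by (rule ext)
  then show ?case using offspring_gf_one_minus[of "hit o' j" z] hit_bounds by simp
qed simp

text \<open>Reverse Fatou: events that have probability at least \<open>d\<close> for infinitely
  many generations occur infinitely often with probability at least \<open>d\<close>.\<close>

lemma q_le_if_hit:
  assumes "\<And>k. \<exists>j\<ge>k. d \<le> hit o' j x"
  shows "q o' x \<le> 1 - d"
proof -
  have "fin_prob G p o' x \<le> ennreal (1 - d)"
    unfolding fin_prob_eq_limit[OF finite_nbrs nbrs_nonempty]
  proof (rule SUP_least)
    fix k
    obtain j where j: "j \<ge> k" "d \<le> hit o' j x" using assms by blast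
    have "(INF n. weight_val G p n (avoid_weight o' k) x) \<le> weight_val G p j (avoid_weight o' k) x"
      by (rule INF_lower) simp
    also have "\<dots> \<le> weight_val G p j (\<lambda>l z. if l = j \<and> z = o' then 0 else 1) x"
      using j by (intro weight_val_mono) (auto simp: avoid_weight_def)
    also have "\<dots> \<le> ennreal (1 - d)" unfolding weight_val_hit using j by (intro ennreal_leI) simp
    finally show "(INF n. weight_val G p n (avoid_weight o' k) x) \<le> ennreal (1 - d)" .
  qed
  moreover have "d \<le> 1" using assms[of 0] hit_bounds order_trans by blast
  ultimately show ?thesis by (simp add: ennreal_q)
qed

text \<open>While values stay below \<open>e\<close>, \<open>surv\<close> dominates multiplication
  by \<open>m\<close>, so hitting probabilities dominate a linear recursion started from
  \<open>d\<close> at \<open>o'\<close>. After \<open>n\<close> generations that recursion has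
  regained \<open>d\<close> at \<open>o'\<close>, and the block can be repeated forever.\<close>

lemma q_less_1:
  assumes m: "ennreal m < offspring_mean p" "0 \<le> m"
    and n: "n > 0" "1 \<le> srw_pn G n o' o' * m ^ n"
  shows "q o' o' < 1"
proof -
  obtain e where e: "0 < e" "e \<le> 1" and surv: "\<And>t. 0 \<le> t \<Longrightarrow> t \<le> e \<Longrightarrow> m * t \<le> surv p t"
    using surv_ge[OF m] by blast
  \<comment> \<open>The base \<open>1 + m\<close>, rather than \<open>m\<close>, keeps
    \<open>d * m ^ i\<close> below \<open>e\<close> for every \<open>i \<le> n\<close> also when
    \<open>m < 1\<close>.\<close>
  define d where "d = e / (1 + m) ^ n"
  have "0 < (1 + m) ^ n" using m by simp
  then have d0: "0 < d" and dm: "d * (1 + m) ^ n = e" using e m by (auto simp: d_def)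
  have de: "d * m ^ i \<le> e" if "i \<le> n" for i
  proof -
    have "m ^ i \<le> (1 + m) ^ i" using m by (intro power_mono) auto
    also have "\<dots> \<le> (1 + m) ^ n" using m that by (intro power_increasing) auto
    finally show ?thesis using mult_left_mono[of "m ^ i" "(1 + m) ^ n" d] d0 dm by simp
  qed
  have d: "0 < d" "d \<le> e" using d0 de[of 0] by auto
  have step: "d * m ^ i * srw_pn G i z o' \<le> hit o' (j + i) z"
    if hit: "\<And>z. (if z = o' then d else 0) \<le> hit o' j z" and "i \<le> n" for i j z
    using that(2)
  proof (induction i arbitrary: z)
    case 0
    then show ?case using hit[of z] by auto
  next
    case (Suc i)
    let ?f = "\<lambda>z. d * m ^ i * srw_pn G i z o'"
    have f0: "0 \<le> ?f z" for z using d m srw_pn_bounds by simp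
    have fe: "?f z \<le> e" for z
    proof -
      have "?f z \<le> d * m ^ i * 1" using d m by (intro mult_left_mono srw_pn_bounds) auto
      also have "\<dots> \<le> e" using de[of i] Suc.prems by simp
      finally show ?thesis .
    qed
    have "d * m ^ Suc i * srw_pn G (Suc i) z o' = m * srw_opR G ?f z"
      unfolding srw_pn_Suc srw_opR_cmult by simp
    also have "\<dots> \<le> surv p (srw_opR G ?f z)"
    proof (rule surv)
      show "0 \<le> srw_opR G ?f z" using srw_opR_mono[of z "\<lambda>_. 0" ?f] f0 by (simp only: srw_opR_const)
      show "srw_opR G ?f z \<le> e" using srw_opR_mono[of z ?f "\<lambda>_. e"] fe by (simp only: srw_opR_const)
    qed
    also have "\<dots> \<le> surv p (srw_opR G (hit o' (j + i)) z)"
    proof (rule surv_mono)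
      show "0 \<le> srw_opR G ?f z" using srw_opR_mono[of z "\<lambda>_. 0" ?f] f0 by (simp only: srw_opR_const)
      show "srw_opR G ?f z \<le> srw_opR G (hit o' (j + i)) z"
        by (rule srw_opR_mono) (rule Suc.IH, use Suc.prems in simp)
      show "srw_opR G (hit o' (j + i)) z \<le> 1" by (rule srw_opR_bounds) (simp_all add: hit_bounds)
    qed
    also have "\<dots> = hit o' (j + Suc i) z" by simp
    finally show ?case .
  qed
  have hit: "(if z = o' then d else 0) \<le> hit o' (r * n) z" for r z
  proof (induction r arbitrary: z)
    case 0
    then show ?case using d e by auto
  next
    case (Suc r)
    have "d * 1 \<le> d * (m ^ n * srw_pn G n o' o')"
      using n d by (intro mult_left_mono) (simp_all add: mult.commute)
    also have "\<dots> \<le> hit o' (r * n + n) o'"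
      using step[of "r * n" n o'] Suc by (simp add: mult.assoc)
    finally have "d \<le> hit o' (Suc r * n) o'" by (simp add: add.commute)
    then show ?case by (simp add: hit_bounds del: mult_Suc)
  qed
  have "q o' o' \<le> 1 - d"
  proof (rule q_le_if_hit)
    fix k
    have "k * n \<ge> k" using n by simp
    moreover have "d \<le> hit o' (k * n) o'" using hit[of o' k] by simp
    ultimately show "\<exists>j\<ge>k. d \<le> hit o' j o'" by blast
  qed
  then show ?thesis using d by simp
qed

section \<open>The subcritical and critical cases\<close>

text \<open>Probability that the walk from \<open>z\<close> first meets \<open>o'\<close> at time
  \<open>k\<close>, where time 0 counts.\<close>

fun first_hit :: "nat \<Rightarrow> nat \<Rightarrow> nat \<Rightarrow> real" where
  "first_hit o' 0 z = (if z = o' then 1 else 0)"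
| "first_hit o' (Suc k) z = (if z = o' then 0 else srw_opR G (first_hit o' k) z)"

lemma first_hit_nonneg: "0 \<le> first_hit o' k z"
proof (induction k arbitrary: z)
  case (Suc k)
  then show ?case using srw_opR_mono[of z "\<lambda>_. 0" "first_hit o' k"] by (simp add: srw_opR_const)
qed simp

lemma srw_pn_renewal:
  "srw_pn G n z o' = (\<Sum>k\<le>n. first_hit o' k z * srw_pn G (n - k) o' o')"
proof (induction n arbitrary: z)
  case (Suc n)
  show ?case
  proof (cases "z = o'")
    case True
    have "(\<Sum>k\<le>Suc n. first_hit o' k z * srw_pn G (Suc n - k) o' o') =
        first_hit o' 0 z * srw_pn G (Suc n) o' o' + (\<Sum>k\<le>n. first_hit o' (Suc k) z * srw_pn G (n - k) o' o')"
      by (subst sum.atMost_Suc_shift) simp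
    then show ?thesis using True by simp
  next
    case False
    have "srw_pn G (Suc n) z o' = srw_opR G (\<lambda>y. \<Sum>k\<le>n. first_hit o' k y * srw_pn G (n - k) o' o') z"
      unfolding srw_pn_Suc using Suc by simp
    also have "\<dots> = (\<Sum>k\<le>n. srw_opR G (first_hit o' k) z * srw_pn G (n - k) o' o')"
      unfolding srw_opR_sum srw_opR_cmult_right ..
    also have "\<dots> = (\<Sum>k\<le>Suc n. first_hit o' k z * srw_pn G (Suc n - k) o' o')"
      by (subst sum.atMost_Suc_shift) (use False in simp)
    finally show ?thesis .
  qed
qed simp

text \<open>Taken after one step, so that the index \<open>k\<close> stands for a first return at
  time \<open>k + 1\<close>; hence the powers \<open>s ^ Suc k\<close> below.\<close>

definition first_return :: "nat \<Rightarrow> nat \<Rightarrow> real" where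
  "first_return o' k = srw_opR G (first_hit o' k) o'"

lemma first_return_nonneg: "0 \<le> first_return o' k"
  unfolding first_return_def
  using srw_opR_mono[of o' "\<lambda>_. 0" "first_hit o' k"] first_hit_nonneg by (simp add: srw_opR_const)

text \<open>From \<open>o'\<close> itself the hit at time 0 makes \<open>srw_pn_renewal\<close>
  trivial, so it is applied after the first step.\<close>

lemma srw_pn_Suc_renewal:
  "srw_pn G (Suc n) o' o' = (\<Sum>k\<le>n. first_return o' k * srw_pn G (n - k) o' o')"
proof -
  have "srw_pn G (Suc n) o' o' = srw_opR G (\<lambda>y. \<Sum>k\<le>n. first_hit o' k y * srw_pn G (n - k) o' o') o'"
    by (simp only: srw_pn_Suc srw_pn_renewal[of n _ o'])
  also have "\<dots> = (\<Sum>k\<le>n. first_return o' k * srw_pn G (n - k) o' o')"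
    unfolding srw_opR_sum first_return_def srw_opR_cmult_right ..
  finally show ?thesis .
qed

text \<open>With Green function \<open>A\<close> and return series \<open>C\<close>, renewal reads
  \<open>A = 1 + C * A\<close>; as \<open>A\<close> is finite and at least 1, \<open>C > 1\<close>
  is impossible. Partial sums of \<open>C\<close> suffice for the argument.\<close>

lemma first_return_gf_le_1:
  assumes s: "0 \<le> s" and sum: "summable (\<lambda>n. srw_pn G n o' o' * s ^ n)"
  shows "(\<Sum>k<K. first_return o' k * s ^ Suc k) \<le> 1"
proof -
  define a where "a n = srw_pn G n o' o' * s ^ n" for n
  define c where "c k = first_return o' k * s ^ Suc k" for k
  have nn: "0 \<le> a n" "0 \<le> c n" for n
    using s srw_pn_bounds first_return_nonneg by (auto simp: a_def c_def)
  have a: "summable a" using sum by (simp add: a_def[abs_def])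
  have rec: "a (Suc n) = (\<Sum>k\<le>n. c k * a (n - k))" for n
  proof -
    have pow: "s ^ Suc n = s ^ Suc k * s ^ (n - k)" if "k \<le> n" for k
      using that by (simp only: power_add[symmetric]) simp
    have "first_return o' k * srw_pn G (n - k) o' o' * s ^ Suc n = c k * a (n - k)" if "k \<le> n" for k
      unfolding c_def a_def pow[OF that] by (simp only: mult_ac)
    then show ?thesis
      unfolding a_def[of "Suc n"] srw_pn_Suc_renewal sum_distrib_right
      by (intro sum.cong refl) simp
  qed
  define A where "A = suminf a"
  have "a 0 = 1" by (simp add: a_def)
  have A: "A = 1 + (\<Sum>n. a (Suc n))" unfolding A_def using suminf_split_head[OF a] \<open>a 0 = 1\<close> by simp
  have shift_le: "(\<Sum>n<N. if k \<le> n then a (n - k) else 0) \<ge> (\<Sum>n<N - k. a n)" for N k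
  proof -
    have "(\<Sum>n<N - k. a n) = (\<Sum>n\<in>{k..<N}. a (n - k))"
      by (rule sum.reindex_bij_witness[of _ "\<lambda>n. n - k" "\<lambda>n. n + k"]) auto
    also have "\<dots> = (\<Sum>n\<in>{k..<N}. if k \<le> n then a (n - k) else 0)"
      by (intro sum.cong) auto
    also have "\<dots> \<le> (\<Sum>n<N. if k \<le> n then a (n - k) else 0)"
      using nn by (intro sum_mono2) auto
    finally show ?thesis .
  qed
  have "(\<Sum>k<K. c k) * (\<Sum>n<N. a n) \<le> A - 1" for N
  proof -
    have "(\<Sum>k<K. c k) * (\<Sum>n<N. a n) = (\<Sum>k<K. c k * (\<Sum>n<N. a n))" by (simp add: sum_distrib_right)
    \<comment> \<open>Enlarging the range to \<open>N + K\<close> lets each of the \<open>K\<close>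
      shifted copies keep its first \<open>N\<close> terms.\<close>
    also have "\<dots> \<le> (\<Sum>k<K. c k * (\<Sum>n<N + K. if k \<le> n then a (n - k) else 0))"
    proof (intro sum_mono mult_left_mono nn)
      fix k assume "k \<in> {..<K}"
      then have "(\<Sum>n<N. a n) \<le> (\<Sum>n<N + K - k. a n)" using nn by (intro sum_mono2) auto
      also note shift_le[of "N + K" k]
      finally show "(\<Sum>n<N. a n) \<le> (\<Sum>n<N + K. if k \<le> n then a (n - k) else 0)" .
    qed
    also have "\<dots> = (\<Sum>n<N + K. \<Sum>k<K. if k \<le> n then c k * a (n - k) else 0)"
    proof -
      have "c k * (\<Sum>n<N + K. if k \<le> n then a (n - k) else 0) =
          (\<Sum>n<N + K. if k \<le> n then c k * a (n - k) else 0)" for k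
        unfolding sum_distrib_left by (intro sum.cong) auto
      then show ?thesis by (simp only: sum.swap[of _ "{..<K}"])
    qed
    also have "\<dots> \<le> (\<Sum>n<N + K. a (Suc n))"
    proof (intro sum_mono)
      fix n
      have "(\<Sum>k<K. if k \<le> n then c k * a (n - k) else 0) = (\<Sum>k\<in>{..<K} \<inter> {..n}. c k * a (n - k))"
        by (subst sum.inter_restrict) auto
      also have "\<dots> \<le> (\<Sum>k\<le>n. c k * a (n - k))"
        using nn by (intro sum_mono2) auto
      finally show "(\<Sum>k<K. if k \<le> n then c k * a (n - k) else 0) \<le> a (Suc n)" by (simp add: rec)
    qed
    also have "\<dots> \<le> (\<Sum>n. a (Suc n))"
      using a nn by (intro sum_le_suminf) (auto simp: summable_Suc_iff)
    finally show ?thesis using A by simp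
  qed
  moreover have "(\<lambda>N. (\<Sum>k<K. c k) * (\<Sum>n<N. a n)) \<longlonglongrightarrow> (\<Sum>k<K. c k) * A"
    unfolding A_def by (rule tendsto_mult_left[OF summable_LIMSEQ[OF a]])
  ultimately have SA: "(\<Sum>k<K. c k) * A \<le> A - 1"
    by (intro LIMSEQ_le_const2) auto
  have A1: "A \<ge> 1" using A nn a by (simp add: suminf_nonneg summable_Suc_iff)
  have "(\<Sum>k<K. c k) \<le> 1"
  proof (rule ccontr)
    assume "\<not> (\<Sum>k<K. c k) \<le> 1"
    then have "1 * A \<le> (\<Sum>k<K. c k) * A" using A1 by (intro mult_right_mono) auto
    then show False using SA by simp
  qed
  then show ?thesis by (simp add: c_def)
qed

text \<open>Left limit of a polynomial bound; summability at \<open>m\<close> itself is not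
  assumed.\<close>

lemma first_return_gf_le_1_limit:
  assumes m: "0 < m" and sum: "\<And>s. 0 < s \<Longrightarrow> s < m \<Longrightarrow> summable (\<lambda>n. srw_pn G n o' o' * s ^ n)"
  shows "(\<Sum>k<K. first_return o' k * m ^ Suc k) \<le> 1"
proof -
  have "((\<lambda>s. \<Sum>k<K. first_return o' k * s ^ Suc k) \<longlongrightarrow> (\<Sum>k<K. first_return o' k * m ^ Suc k)) (at_left m)"
    by (intro tendsto_intros)
  moreover have "\<forall>\<^sub>F s in at_left m. (\<Sum>k<K. first_return o' k * s ^ Suc k) \<le> 1"
    using eventually_at_left_real[OF m]
    by eventually_elim (intro first_return_gf_le_1 sum, auto)
  ultimately show ?thesis
    by (intro tendsto_upperbound) auto
qed

text \<open>Probability of visiting \<open>o'\<close> by generation \<open>n\<close>; the value 1 at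
  \<open>o'\<close> stops the recursion there, in step with \<open>first_hit\<close>.\<close>

fun hit_within :: "nat \<Rightarrow> nat \<Rightarrow> nat \<Rightarrow> real" where
  "hit_within o' 0 z = (if z = o' then 1 else 0)"
| "hit_within o' (Suc n) z = (if z = o' then 1 else surv p (srw_opR G (hit_within o' n) z))"

lemma hit_within_bounds: "0 \<le> hit_within o' n z \<and> hit_within o' n z \<le> 1"
proof (induction n arbitrary: z)
  case (Suc n)
  then show ?case using surv_bounds srw_opR_bounds[of "hit_within o' n" z] by simp
qed simp

lemma weight_val_hit_within:
  "weight_val G p n (avoid_weight o' 0) z = ennreal (1 - hit_within o' n z)"
proof (induction n arbitrary: z)
  case 0
  then show ?case by (simp add: avoid_weight_def)
next
  case (Suc n)
  have "(\<lambda>l. avoid_weight o' 0 (Suc l)) = avoid_weight o' 0"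
    by (simp add: avoid_weight_def fun_eq_iff)
  moreover have "weight_val G p n (avoid_weight o' 0) = (\<lambda>z. ennreal (1 - hit_within o' n z))"
    using Suc by (rule ext)
  moreover have "avoid_weight o' 0 0 z = (if z = o' then 0 else 1)"
    by (simp add: avoid_weight_def)
  ultimately show ?case
    using offspring_gf_one_minus[of "hit_within o' n" z] hit_within_bounds by simp
qed

text \<open>Union bound: some ancestral line must meet \<open>o'\<close> for the first time, and
  \<open>m ^ k * first_hit o' k z\<close> bounds the expected number of lines that do so in
  generation \<open>k\<close>.\<close>

lemma hit_within_le:
  assumes "offspring_mean p \<le> ennreal m" "0 \<le> m"
  shows "hit_within o' n z \<le> (\<Sum>k\<le>n. m ^ k * first_hit o' k z)"
proof (induction n arbitrary: z)
  case (Suc n)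
  show ?case
  proof (cases "z = o'")
    case True
    have "(\<Sum>k\<le>Suc n. m ^ k * first_hit o' k z) = 1 + (\<Sum>k\<le>n. m ^ Suc k * first_hit o' (Suc k) z)"
      by (subst sum.atMost_Suc_shift) (use True in simp)
    also have "\<dots> = 1" using True by simp
    finally show ?thesis using True by simp
  next
    case False
    have "hit_within o' (Suc n) z \<le> m * srw_opR G (hit_within o' n) z"
      using False assms srw_opR_bounds[of "hit_within o' n" z] hit_within_bounds
      by (auto intro!: surv_le)
    also have "\<dots> \<le> m * srw_opR G (\<lambda>y. \<Sum>k\<le>n. m ^ k * first_hit o' k y) z"
      using assms Suc by (intro mult_left_mono srw_opR_mono) auto
    also have "\<dots> = (\<Sum>k\<le>n. m ^ Suc k * first_hit o' (Suc k) z)"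
      using False by (simp add: srw_opR_sum srw_opR_cmult sum_distrib_left mult.assoc)
    also have "\<dots> = (\<Sum>k\<le>Suc n. m ^ k * first_hit o' k z)"
      by (subst sum.atMost_Suc_shift) (use False in simp)
    finally show ?thesis .
  qed
qed simp

lemma srw_op_cmult: "srw_op G (\<lambda>z. c * w z) x = c * srw_op G w x"
  by (simp add: srw_op_eq sum_distrib_left[symmetric] mult.assoc)

lemma srw_op_add: "srw_op G (\<lambda>z. v z + w z) x = srw_op G v x + srw_op G w x"
  by (simp add: srw_op_eq sum.distrib distrib_right)

lemma srw_op_sum: "finite I \<Longrightarrow> srw_op G (\<lambda>z. \<Sum>i\<in>I. w i z) x = (\<Sum>i\<in>I. srw_op G (w i) x)"
  by (induction I rule: finite_induct) (simp_all add: srw_op_add, simp add: srw_op_eq)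

lemma srw_op_suminf: "srw_op G (\<lambda>z. \<Sum>k. w k z) x = (\<Sum>k. srw_op G (w k) x)"
  unfolding srw_op_eq by (subst suminf_sum[symmetric]) (auto simp: summableI)

text \<open>For \<open>n = 0\<close> this is the first-moment bound for visiting the target at all; each application
  of \<open>1 - q \<le> m P (1 - q)\<close> moves one term of the series behind the factor \<open>1 - q o' o'\<close>.\<close>

lemma one_minus_q_le:
  assumes mean: "offspring_mean p \<le> ennreal m" and m: "0 \<le> m"
  shows "ennreal (1 - q o' z) \<le>
    ennreal (1 - q o' o') * (\<Sum>k<n. ennreal (m ^ k * first_hit o' k z)) +
    (\<Sum>k. ennreal (m ^ (k + n) * first_hit o' (k + n) z))"
proof (induction n arbitrary: z)
  case 0
  let ?A = "\<Sum>k. ennreal (m ^ k * first_hit o' k z)"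
  have nn: "0 \<le> m ^ k * first_hit o' k z" for k using m first_hit_nonneg by simp
  have "1 - ?A \<le> (INF n. weight_val G p n (avoid_weight o' 0) z)"
  proof (rule INF_greatest)
    fix n
    have "ennreal (hit_within o' n z) \<le> ennreal (\<Sum>k\<le>n. m ^ k * first_hit o' k z)"
      by (intro ennreal_leI hit_within_le mean m)
    also have "\<dots> = (\<Sum>k\<le>n. ennreal (m ^ k * first_hit o' k z))" using nn by simp
    also have "\<dots> \<le> ?A" by (rule sum_le_suminf) auto
    finally have "1 - ?A \<le> 1 - ennreal (hit_within o' n z)" by (rule ennreal_minus_mono[OF order_refl])
    also have "\<dots> = ennreal (1 - hit_within o' n z)"
      using hit_within_bounds[of o' n z] ennreal_minus[of "hit_within o' n z" 1] by simp
    finally show "1 - ?A \<le> weight_val G p n (avoid_weight o' 0) z"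
      by (simp add: weight_val_hit_within)
  qed
  \<comment> \<open>The index \<open>k = 0\<close>: never visiting is a case of finitely many
    visits.\<close>
  also have "\<dots> \<le> fin_prob G p o' z"
    unfolding fin_prob_eq_limit[OF finite_nbrs nbrs_nonempty] by (rule SUP_upper) simp
  finally have "1 - ?A \<le> ennreal (q o' z)" by (simp add: ennreal_q)
  then have "1 - ennreal (q o' z) \<le> ?A"
    unfolding ennreal_minus_le_iff by (simp add: add.commute)
  moreover have "1 - ennreal (q o' z) = ennreal (1 - q o' z)"
    using ennreal_minus[of "q o' z" 1] q_bounds by simp
  ultimately show ?case by simp
next
  case (Suc n)
  let ?a = "\<lambda>k z. ennreal (m ^ k * first_hit o' k z)"
  have nn: "0 \<le> m ^ k * first_hit o' k z" for k z using m first_hit_nonneg by simp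
  show ?case
  proof (cases "z = o'")
    case True
    have "(\<Sum>k<Suc n. ?a k z) = ?a 0 z + (\<Sum>k<n. ?a (Suc k) z)" by (rule sum.lessThan_Suc_shift)
    then have "1 \<le> (\<Sum>k<Suc n. ?a k z)" using True by simp
    then have "ennreal (1 - q o' o') * 1 \<le> ennreal (1 - q o' o') * (\<Sum>k<Suc n. ?a k z)"
      by (rule mult_left_mono) simp
    also have "\<dots> \<le> \<dots> + (\<Sum>k. ?a (k + Suc n) z)" by simp
    finally show ?thesis using True by simp
  next
    case False
    have sa: "ennreal m * srw_op G (?a k) z = ?a (Suc k) z" for k
      using False nn m
      by (simp add: srw_op_ennreal srw_opR_cmult ennreal_mult'[symmetric] mult.assoc)
    have b: "0 \<le> srw_opR G (\<lambda>z. 1 - q o' z) z" "srw_opR G (\<lambda>z. 1 - q o' z) z \<le> 1"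
      by (auto intro!: srw_opR_bounds simp: q_bounds)
    have "1 - q o' z = surv p (srw_opR G (\<lambda>z. 1 - q o' z) z)"
      using q_branching[of o' z] by (simp add: surv_def srw_opR_one_minus)
    also have "\<dots> \<le> m * srw_opR G (\<lambda>z. 1 - q o' z) z"
      by (intro surv_le mean m b)
    finally have "ennreal (1 - q o' z) \<le> ennreal m * srw_op G (\<lambda>z. ennreal (1 - q o' z)) z"
      using m b by (simp add: srw_op_ennreal q_bounds ennreal_mult[symmetric] ennreal_leI)
    also have "\<dots> \<le> ennreal m * srw_op G (\<lambda>z. ennreal (1 - q o' o') * (\<Sum>k<n. ?a k z) + (\<Sum>k. ?a (k + n) z)) z"
      by (intro mult_left_mono srw_op_mono Suc) simp
    also have "\<dots> = ennreal (1 - q o' o') * (\<Sum>k<n. ennreal m * srw_op G (?a k) z) +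
        (\<Sum>k. ennreal m * srw_op G (?a (k + n)) z)"
      by (simp add: srw_op_add srw_op_cmult srw_op_sum srw_op_suminf distrib_left sum_distrib_left
          mult.left_commute)
    also have "\<dots> = ennreal (1 - q o' o') * (\<Sum>k<n. ?a (Suc k) z) + (\<Sum>k. ?a (k + Suc n) z)"
      by (simp only: sa add_Suc_right)
    also have "(\<Sum>k<n. ?a (Suc k) z) = (\<Sum>k<Suc n. ?a k z)"
      unfolding sum.lessThan_Suc_shift using False by simp
    finally show ?thesis .
  qed
qed

text \<open>With \<open>h = P (1 - q)\<close> at \<open>o'\<close>, the bound
  \<open>one_minus_q_le\<close> applied after one step gives, as \<open>n\<close> grows,
  \<open>m * h \<le> 1 - q o' o' = surv p h\<close>, because the return series is at most 1. Since
  \<open>surv p h < m * h\<close> for \<open>h > 0\<close>, only \<open>h = 0\<close>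
  remains.\<close>

lemma q_eq_1:
  assumes mean: "offspring_mean p \<le> ennreal m" and m: "0 < m"
    and sum: "\<And>s. 0 < s \<Longrightarrow> s < m \<Longrightarrow> summable (\<lambda>n. srw_pn G n o' o' * s ^ n)"
  shows "q o' o' = 1"
proof -
  define b where "b k = first_return o' k * m ^ Suc k" for k
  have b0: "0 \<le> b k" for k using m first_return_nonneg by (simp add: b_def)
  have b1: "(\<Sum>k<K. b k) \<le> 1" for K
    unfolding b_def by (rule first_return_gf_le_1_limit[OF m sum])
  have bs: "summable b"
    by (rule summableI_nonneg_bounded[OF b0 b1])
  define h where "h = srw_opR G (\<lambda>z. 1 - q o' z) o'"
  have h: "0 \<le> h" "h \<le> 1" unfolding h_def by (auto intro!: srw_opR_bounds simp: q_bounds)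
  have qo: "1 - q o' o' = surv p h"
    using q_branching[of o' o'] by (simp add: surv_def srw_opR_one_minus h_def)
  let ?a = "\<lambda>k z. ennreal (m ^ k * first_hit o' k z)"
  have nn: "0 \<le> m ^ k * first_hit o' k z" for k z using m first_hit_nonneg by simp
  have sa: "ennreal m * srw_op G (?a k) o' = ennreal (b k)" for k
    using nn m first_return_nonneg[of o' k]
    by (simp add: srw_op_ennreal srw_opR_cmult ennreal_mult[symmetric] first_return_def b_def mult_ac)
  have le: "m * h \<le> (1 - q o' o') + (\<Sum>k. b (k + n))" for n
  proof -
    have bsn: "summable (\<lambda>k. b (k + n))" using bs by (simp add: summable_iff_shift)
    have e: "0 \<le> 1 - q o' o'" "0 \<le> (\<Sum>k<n. b k)" "0 \<le> (\<Sum>k. b (k + n))"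
      using b0 bsn by (auto simp: q_bounds sum_nonneg suminf_nonneg)
    have "ennreal (m * h) = ennreal m * srw_op G (\<lambda>z. ennreal (1 - q o' z)) o'"
      using m h by (simp add: srw_op_ennreal q_bounds h_def ennreal_mult)
    also have "\<dots> \<le> ennreal m * srw_op G (\<lambda>z. ennreal (1 - q o' o') * (\<Sum>k<n. ?a k z) + (\<Sum>k. ?a (k + n) z)) o'"
      using m by (intro mult_left_mono srw_op_mono one_minus_q_le mean) simp_all
    also have "\<dots> = ennreal (1 - q o' o') * (\<Sum>k<n. ennreal m * srw_op G (?a k) o') +
        (\<Sum>k. ennreal m * srw_op G (?a (k + n)) o')"
      by (simp add: srw_op_add srw_op_cmult srw_op_sum srw_op_suminf distrib_left sum_distrib_left
          mult.left_commute)
    also have "\<dots> = ennreal (1 - q o' o') * ennreal (\<Sum>k<n. b k) + ennreal (\<Sum>k. b (k + n))"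
      unfolding sa by (simp add: b0 suminf_ennreal2[OF _ bsn])
    also have "\<dots> = ennreal ((1 - q o' o') * (\<Sum>k<n. b k) + (\<Sum>k. b (k + n)))"
      by (simp only: ennreal_mult[OF e(1,2)] ennreal_plus[OF mult_nonneg_nonneg[OF e(1,2)] e(3)])
    finally have "m * h \<le> (1 - q o' o') * (\<Sum>k<n. b k) + (\<Sum>k. b (k + n))"
      by (rule ennreal_le_iff[THEN iffD1, rotated]) (intro add_nonneg_nonneg mult_nonneg_nonneg e)
    moreover have "(1 - q o' o') * (\<Sum>k<n. b k) \<le> (1 - q o' o') * 1"
      by (intro mult_left_mono b1) (simp add: q_bounds)
    ultimately show ?thesis by simp
  qed
  have "(\<lambda>n. (1 - q o' o') + (\<Sum>k. b (k + n))) \<longlonglongrightarrow> (1 - q o' o') + 0"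
    by (intro tendsto_intros suminf_exist_split2 bs)
  then have "m * h \<le> 1 - q o' o'"
    using le by (intro LIMSEQ_le_const[where X="\<lambda>n. (1 - q o' o') + (\<Sum>k. b (k + n))"]) auto
  then have "\<not> 0 < h"
    using surv_less[OF mean _ _ h(2) p0 p1] m qo by auto
  then have "h = 0" using h by simp
  then have "q o' o' = gfR p 1"
    using qo by (simp add: surv_def)
  then show ?thesis by (simp add: gfR_def)
qed

end

section \<open>The spectral radius\<close>

context bounded_graph
begin

abbreviation srw_root :: "nat \<Rightarrow> nat \<Rightarrow> real" where
  "srw_root x n \<equiv> srw_pn G n x x powr (1 / real n)"

lemma srw_root_bounds: "0 \<le> srw_root x n" "srw_root x n \<le> 1"
  using srw_pn_bounds[of n x x] by (auto intro: powr_le1)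

text \<open>The roots lie in \<open>[0, 1]\<close>, so the limsup is finite and
  \<open>real_of_ereal\<close> loses nothing.\<close>

lemma limsup_srw_root: "limsup (\<lambda>n. ereal (srw_root x n)) = ereal (spectral_radius G x x)"
proof -
  have "limsup (\<lambda>n. ereal (srw_root x n)) \<le> limsup (\<lambda>n. 1)"
    using srw_root_bounds by (intro Limsup_mono always_eventually) auto
  moreover have "liminf (\<lambda>n. 0) \<le> limsup (\<lambda>n. ereal (srw_root x n))"
    using srw_root_bounds by (intro order_trans[OF Liminf_mono Liminf_le_Limsup] always_eventually) auto
  ultimately show ?thesis
    unfolding spectral_radius_def
    by (subst ereal_real) (auto simp: Limsup_const Liminf_const)
qed

text \<open>Step to a neighbour and straight back; the step back has probability at least
  \<open>1 / D\<close>.\<close>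

lemma srw_pn_two_steps: "srw_pn G n x x / real D \<le> srw_pn G (Suc (Suc n)) x x"
proof -
  have D: "real D > 0" using deg_le[of x] deg_pos[of x] by linarith
  have "srw_pn G n x x / real D \<le> srw_pn G (Suc n) z x" if z: "z \<in> nbrs G x" for z
  proof -
    have "srw_pn G n x x / real D \<le> srw_pn G n x x / real (deg G z)"
      using srw_pn_bounds deg_le[of z] D by (intro divide_left_mono) auto
    also have "\<dots> \<le> srw_pn G (Suc n) z x"
      unfolding srw_pn_Suc srw_opR_eq
      using z srw_pn_bounds nbrs_sym by (intro divide_right_mono member_le_sum) auto
    finally show ?thesis .
  qed
  then have "srw_opR G (\<lambda>_. srw_pn G n x x / real D) x \<le> srw_opR G (\<lambda>z. srw_pn G (Suc n) z x) x"
    by (rule srw_opR_mono)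
  then show ?thesis unfolding srw_pn_Suc[of "Suc n"] by (simp only: srw_opR_const)
qed

text \<open>Only even times are used, since return probabilities at odd times may all be 0.
  Positivity gives \<open>1 / spectral_radius G x x\<close> its meaning, as division by 0 yields
  0.\<close>

lemma spectral_radius_pos: "0 < spectral_radius G x x"
proof -
  have D: "real D > 0" using deg_le[of x] deg_pos[of x] by linarith
  have even: "(1 / D) ^ n \<le> srw_pn G (2 * n) x x" for n
  proof (induction n)
    case (Suc n)
    have "(1 / real D) ^ Suc n \<le> srw_pn G (2 * n) x x / D"
      using Suc D by (simp add: divide_right_mono)
    also have "\<dots> \<le> srw_pn G (2 * Suc n) x x"
      using srw_pn_two_steps[of "2 * n" x] by simp
    finally show ?case .
  qed simp
  \<comment> \<open>A return in two steps costs at most a factor \<open>1 / D\<close>, hence the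
    square root per step.\<close>
  define c where "c = (1 / real D) powr (1 / 2)"
  have "c \<le> srw_root x (2 * Suc n)" for n
  proof -
    have "(1 / D) ^ Suc n = (1 / D) powr real (Suc n)"
      using D by (intro powr_realpow[symmetric]) simp
    moreover have "real (Suc n) * (1 / real (2 * Suc n)) = 1 / 2" by (simp add: field_simps)
    ultimately have "c = ((1 / D) ^ Suc n) powr (1 / real (2 * Suc n))"
      unfolding c_def by (simp only: powr_powr)
    also have "\<dots> \<le> srw_root x (2 * Suc n)"
      using even[of "Suc n"] D by (intro powr_mono2) auto
    finally show ?thesis .
  qed
  then have "ereal c \<le> liminf ((\<lambda>n. ereal (srw_root x n)) \<circ> (\<lambda>n. 2 * Suc n))"
    by (intro Liminf_bounded always_eventually) auto
  also have "\<dots> \<le> limsup ((\<lambda>n. ereal (srw_root x n)) \<circ> (\<lambda>n. 2 * Suc n))"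
    by (rule Liminf_le_Limsup) simp
  also have "\<dots> \<le> limsup (\<lambda>n. ereal (srw_root x n))"
    by (rule limsup_subseq_mono) (auto simp: strict_mono_def)
  finally have "c \<le> spectral_radius G x x" by (simp add: limsup_srw_root)
  moreover have "c > 0" using D by (simp add: c_def)
  ultimately show ?thesis by linarith
qed

lemma exists_large_return_prob:
  assumes "1 / spectral_radius G x x < m"
  obtains n where "n > 0" "1 \<le> srw_pn G n x x * m ^ n"
proof -
  have m: "m > 0" "1 / m < spectral_radius G x x"
  proof -
    have "0 < 1 / spectral_radius G x x" using spectral_radius_pos by simp
    then show "m > 0" using assms by linarith
    then show "1 / m < spectral_radius G x x"
      using assms spectral_radius_pos[of x] by (simp add: field_simps)
  qed
  have "\<exists>n>0. 1 \<le> srw_pn G n x x * m ^ n"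
  proof (rule ccontr)
    assume neg: "\<not> ?thesis"
    have "srw_root x n \<le> 1 / m" if "n > 0" for n
    proof -
      have "srw_pn G n x x * m ^ n \<le> 1" using neg that by (meson nle_le)
      then have "srw_pn G n x x \<le> (1 / m) ^ n"
        using m by (simp add: power_one_over pos_le_divide_eq)
      then have "srw_root x n \<le> ((1 / m) ^ n) powr (1 / n)"
        using srw_pn_bounds by (intro powr_mono2) auto
      also have "\<dots> = 1 / m" using m that by (simp add: powr_realpow[symmetric] powr_powr)
      finally show ?thesis .
    qed
    then have "limsup (\<lambda>n. ereal (srw_root x n)) \<le> ereal (1 / m)"
      by (intro Limsup_bounded) (auto simp: eventually_sequentially intro!: exI[of _ 1])
    then show False using m by (simp add: limsup_srw_root)
  qed
  then show ?thesis using that by blast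
qed

text \<open>Root test with ratio \<open>c * s < 1\<close>, where \<open>c\<close> lies strictly
  between the spectral radius and \<open>1 / s\<close>.\<close>

lemma summable_return_gf:
  assumes s: "0 < s" "s < 1 / spectral_radius G x x"
  shows "summable (\<lambda>n. srw_pn G n x x * s ^ n)"
proof -
  have "spectral_radius G x x < 1 / s"
    using s spectral_radius_pos[of x] by (simp add: field_simps)
  then obtain c where c: "spectral_radius G x x < c" "c < 1 / s" using dense by blast
  have c0: "0 < c" using c spectral_radius_pos[of x] by linarith
  have "limsup (\<lambda>n. ereal (srw_root x n)) < ereal c" using c by (simp add: limsup_srw_root)
  then have "\<forall>\<^sub>F n in sequentially. ereal (srw_root x n) < ereal c"
    by (rule Limsup_lessD)
  then obtain N where N: "\<And>n. n \<ge> N \<Longrightarrow> srw_root x n < c"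
    by (auto simp: eventually_sequentially)
  show ?thesis
  proof (rule summable_comparison_test)
    \<comment> \<open>Starting at \<open>Suc N\<close> excludes \<open>n = 0\<close>, where taking
      the root cannot be undone.\<close>
    have "norm (srw_pn G n x x * s ^ n) \<le> (c * s) ^ n" if "n \<ge> Suc N" for n
    proof -
      have n: "n > 0" "n \<ge> N" using that by auto
      have "srw_pn G n x x \<le> c ^ n"
      proof (cases "srw_pn G n x x = 0")
        case False
        then have pos: "0 < srw_pn G n x x" using srw_pn_bounds[of n x x] by simp
        have "srw_pn G n x x = srw_root x n ^ n"
          using pos n by (simp add: powr_realpow[symmetric] powr_powr)
        also have "\<dots> \<le> c ^ n" using N[OF n(2)] by (intro power_mono) auto
        finally show ?thesis .
      qed (use c0 in simp)
      then show ?thesis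
        using s srw_pn_bounds by (auto simp: power_mult_distrib intro: mult_right_mono)
    qed
    then show "\<exists>N. \<forall>n\<ge>N. norm (srw_pn G n x x * s ^ n) \<le> (c * s) ^ n" by blast
    show "summable (\<lambda>n. (c * s) ^ n)"
      using c c0 s by (intro summable_geometric) (auto simp: field_simps)
  qed
qed

end

context brw
begin

lemma q_less_1_supercritical:
  assumes "ennreal (1 / spectral_radius G x x) < offspring_mean p"
  shows "q x x < 1"
proof -
  \<comment> \<open>A finite intermediate value, as the mean itself may be infinite.\<close>
  obtain M where M: "ennreal (1 / spectral_radius G x x) < M" "M < offspring_mean p"
    using dense[OF assms] by blast
  then obtain m where m: "M = ennreal m" "0 \<le> m" by (cases M) auto
  then have "1 / spectral_radius G x x < m"
    using M spectral_radius_pos[of x] by (simp add: ennreal_less_iff)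
  then obtain n where "n > 0" "1 \<le> srw_pn G n x x * m ^ n"
    by (rule exists_large_return_prob)
  then show ?thesis using M m by (intro q_less_1[of m]) auto
qed

lemma q_eq_1_subcritical:
  assumes "offspring_mean p \<le> ennreal (1 / spectral_radius G x x)"
  shows "q x x = 1"
  by (rule q_eq_1[OF assms]) (use spectral_radius_pos[of x] in \<open>auto intro: summable_return_gf\<close>)

lemma transient_subcritical:
  assumes "offspring_mean p \<le> ennreal (1 / spectral_radius G x x)"
  shows "transient G p"
  unfolding transient_def brw_alpha_q
  using q_eq_1_everywhere[OF q_eq_1_subcritical[OF assms]] q_target[of x] by simp

lemma strongly_recurrent_if_q_0: "q x x = 0 \<Longrightarrow> strongly_recurrent G p"
  unfolding strongly_recurrent_def brw_alpha_q
  using q_eq_0_everywhere[of x x] q_target[of x] by simp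

end

section \<open>The mass transport\<close>

lemma measurable_edge [measurable]: "Measurable.pred graph_space (\<lambda>G. G e)"
  unfolding graph_space_def by (rule measurable_component_singleton) simp

lemma measurable_srw_op:
  assumes [measurable]: "\<And>z. (\<lambda>G. w G z) \<in> borel_measurable graph_space"
  shows "(\<lambda>G. srw_op G (w G) x) \<in> borel_measurable graph_space"
  unfolding srw_op_def by measurable

lemma measurable_offspring_gf [measurable]: "offspring_gf p \<in> borel_measurable borel"
proof -
  have "offspring_gf p = (\<lambda>s. \<Sum>k. ennreal (pmf p k) * s ^ k)"
    by (simp add: fun_eq_iff offspring_gf_def nn_integral_measure_pmf nn_integral_count_space_nat)
  then show ?thesis by simp
qed

lemma measurable_weight_val [measurable]:
  "(\<lambda>G. weight_val G p n \<phi> x) \<in> borel_measurable graph_space"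
proof (induction n arbitrary: \<phi> x)
  case (Suc n)
  note [measurable] = measurable_srw_op[OF Suc]
  show ?case by simp
qed simp

lemma suminf_bij_ennreal:
  fixes f :: "nat \<Rightarrow> ennreal"
  assumes "bij \<pi>"
  shows "(\<Sum>z. f (\<pi> z)) = (\<Sum>z. f z)"
  using nn_integral_bij_count_space[OF assms, of f] by (simp add: nn_integral_count_space_nat)

lemma srw_op_relabel:
  assumes "bij \<pi>"
  shows "srw_op (G \<circ> map_prod \<pi> \<pi>) w x = srw_op G (\<lambda>z. w (inv \<pi> z)) (\<pi> x)"
proof -
  have inv: "inv \<pi> (\<pi> z) = z" for z using assms by (simp add: bij_is_inj)
  show ?thesis
    unfolding srw_op_def
    using suminf_bij_ennreal[OF assms, of "\<lambda>z. if G (\<pi> x, z) then w (inv \<pi> z) else 0"]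
      suminf_bij_ennreal[OF assms, of "\<lambda>z. if G (\<pi> x, z) then 1 else 0"]
    by (simp add: inv cong: if_cong)
qed

lemma weight_val_relabel:
  assumes "bij \<pi>"
  shows "weight_val (G \<circ> map_prod \<pi> \<pi>) p n \<phi> x = weight_val G p n (\<lambda>l z. \<phi> l (inv \<pi> z)) (\<pi> x)"
proof (induction n arbitrary: \<phi> x)
  case 0
  then show ?case using assms by (simp add: bij_is_inj)
next
  case (Suc n)
  have "\<pi> (inv \<pi> z) = z" for z using assms by (simp add: bij_is_surj surj_f_inv_f)
  then show ?case
    using assms by (simp add: srw_op_relabel Suc bij_is_inj del: o_apply)
qed

text \<open>On good graphs \<open>fin_visit G p x\<close> is the probability that the branching random walk started
  at \<open>x\<close> returns only finitely often, but this form is visibly measurable in \<open>G\<close> and invariant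
  under relabelling, although \<open>brw_pos\<close> depends on the ordering of the neighbours.\<close>

definition fin_visit :: "graph \<Rightarrow> nat pmf \<Rightarrow> nat \<Rightarrow> ennreal" where
  "fin_visit G p x = (SUP k. INF n. weight_val G p n (avoid_weight x k) x)"

lemma measurable_fin_visit [measurable]: "(\<lambda>G. fin_visit G p x) \<in> borel_measurable graph_space"
  unfolding fin_visit_def by measurable

lemma fin_visit_relabel:
  assumes "bij \<pi>"
  shows "fin_visit (G \<circ> map_prod \<pi> \<pi>) p x = fin_visit G p (\<pi> x)"
proof -
  have "(\<lambda>l z. avoid_weight x k l (inv \<pi> z)) = avoid_weight (\<pi> x) k" for k
    using assms by (auto simp: avoid_weight_def fun_eq_iff bij_is_inj bij_is_surj surj_f_inv_f)
  then show ?thesis by (simp add: fin_visit_def weight_val_relabel[OF assms])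
qed

definition transport :: "nat pmf \<Rightarrow> (graph \<times> nat) \<times> nat \<Rightarrow> ennreal" where
  "transport p = (\<lambda>((G, r), x). if G (r, x) then fin_visit G p x else 0)"

lemma measurable_transport [measurable]: "transport p \<in> borel_measurable birooted_space"
proof -
  have [measurable]: "fst \<in> measurable rooted_space graph_space"
    "snd \<in> measurable rooted_space (count_space UNIV)"
    "fst \<in> measurable birooted_space rooted_space"
    "snd \<in> measurable birooted_space (count_space UNIV)"
    unfolding rooted_space_def birooted_space_def by measurable
  have "(\<lambda>y. if fst (fst y) (r, x) then fin_visit (fst (fst y)) p x else 0) \<in> borel_measurable birooted_space" for r x
    by measurable
  then have "(\<lambda>y. if fst (fst y) (snd (fst y), x) then fin_visit (fst (fst y)) p x else 0) \<in> borel_measurable birooted_space" for x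
    by (rule measurable_compose_countable[where g="\<lambda>y. snd (fst y)"]) measurable
  then have "(\<lambda>y. if fst (fst y) (snd (fst y), snd y) then fin_visit (fst (fst y)) p (snd y) else 0) \<in> borel_measurable birooted_space"
    by (rule measurable_compose_countable[where g="snd"]) measurable
  then show ?thesis by (simp add: transport_def case_prod_beta')
qed

lemma iso_invariant2_transport: "iso_invariant2 (transport p)"
  unfolding iso_invariant2_def by (auto simp: transport_def fin_visit_relabel)

context brw
begin

lemma fin_visit_eq: "fin_visit G p x = ennreal (q x x)"
  by (simp add: fin_visit_def fin_prob_eq_limit[symmetric] ennreal_q)

text \<open>The mass received by \<open>x\<close> is the diagonal value \<open>q x x\<close>;
  \<open>q_target\<close> replaces it by \<open>q r x\<close>, so that the sum becomes the
  transition operator applied to a single function.\<close>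

lemma transport_out: "(\<Sum>x. transport p ((G, r), x)) = ennreal (real (deg G r) * srw_opR G (q r) r)"
proof -
  have "(\<Sum>x. transport p ((G, r), x)) = (\<Sum>x\<in>nbrs G r. ennreal (q r x))"
    by (subst suminf_finite[of "nbrs G r"])
      (auto simp: transport_def nbrs_def fin_visit_eq finite_nbrs[unfolded nbrs_def]
        intro!: sum.cong arg_cong[where f=ennreal] q_target)
  then show ?thesis by (simp add: q_bounds srw_opR_eq)
qed

lemma transport_in: "(\<Sum>x. transport p ((G, x), r)) = ennreal (real (deg G r) * q r r)"
proof -
  have "transport p ((G, x), r) = (if x \<in> nbrs G r then ennreal (q r r) else 0)" for x
    by (simp add: transport_def nbrs_def edge_sym[of x r] fin_visit_eq)
  then have "(\<Sum>x. transport p ((G, x), r)) = (\<Sum>x\<in>nbrs G r. ennreal (q r r))"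
    by (subst suminf_finite[of "nbrs G r"]) auto
  then show ?thesis by (simp add: q_bounds ennreal_mult deg_def ennreal_of_nat_eq_real_of_nat)
qed

text \<open>\<open>q = g (P q) \<le> P q\<close> always holds; the assumption is the reverse
  inequality, so \<open>P q\<close> is a fixed point of \<open>g\<close>.\<close>

lemma q_zero_one:
  assumes "srw_opR G (q x) x \<le> q x x"
  shows "q x x = 0 \<or> q x x = 1"
proof -
  let ?s = "srw_opR G (q x) x"
  have b: "0 \<le> ?s" "?s \<le> 1" by (auto intro!: srw_opR_bounds simp: q_bounds)
  have "gfR p ?s = q x x" by (rule q_branching[symmetric])
  moreover have "q x x \<le> ?s" using gfR_le[OF p0 b] by (simp add: q_branching[symmetric])
  ultimately have "gfR p ?s = ?s" "q x x = ?s" using assms by auto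
  then show ?thesis using gfR_less[OF p0 p1, of ?s] b by force
qed

end

theorem theorem2p2:
  fixes \<nu> :: "(graph \<times> nat) measure" and p :: "nat pmf" and D :: nat
  assumes "unimodular \<nu>"
    and "AE Gr in \<nu>. good_graph (fst Gr) D"
    and "pmf p 0 = 0" and "pmf p 1 < 1"
  shows "AE Gr in \<nu>.
           (ennreal (1 / spectral_radius (fst Gr) (snd Gr) (snd Gr)) < offspring_mean p
              \<longrightarrow> strongly_recurrent (fst Gr) p) \<and>
           (offspring_mean p \<le> ennreal (1 / spectral_radius (fst Gr) (snd Gr) (snd Gr))
              \<longrightarrow> transient (fst Gr) p)"
proof -
  interpret prob_space \<nu> using assms(1) by (simp add: unimodular_def)
  have sets [measurable_cong]: "sets \<nu> = sets rooted_space"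
    using assms(1) by (simp add: unimodular_def)
  define Lo where "Lo Gr = (\<Sum>x. transport p ((fst Gr, snd Gr), x))" for Gr
  define Li where "Li Gr = (\<Sum>x. transport p ((fst Gr, x), snd Gr))" for Gr
  have [measurable]: "fst \<in> measurable rooted_space graph_space"
    "snd \<in> measurable rooted_space (count_space UNIV)"
    unfolding rooted_space_def by measurable
  have "(\<lambda>Gr. ((fst Gr, snd Gr), x)) \<in> measurable rooted_space birooted_space"
    "(\<lambda>Gr. ((fst Gr, x), snd Gr)) \<in> measurable rooted_space birooted_space" for x
    by (simp_all add: birooted_space_def rooted_space_def)
  note m = measurable_compose[OF this(1) measurable_transport] measurable_compose[OF this(2) measurable_transport]
  have "Lo \<in> borel_measurable rooted_space"
    unfolding Lo_def by (intro borel_measurable_suminf_order m)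
  moreover have "Li \<in> borel_measurable rooted_space"
    unfolding Li_def by (intro borel_measurable_suminf_order m)
  ultimately have mL [measurable]: "Lo \<in> borel_measurable \<nu>" "Li \<in> borel_measurable \<nu>"
    by (simp_all only: measurable_cong_sets[OF sets refl])
  have eq: "(\<integral>\<^sup>+Gr. Lo Gr \<partial>\<nu>) = (\<integral>\<^sup>+Gr. Li Gr \<partial>\<nu>)"
    using assms(1) measurable_transport iso_invariant2_transport unfolding Lo_def Li_def unimodular_def by blast
  have brw: "brw G D p" if "good_graph G D" for G
    using that assms(3,4) by (unfold_locales) auto
  \<comment> \<open>The bound by \<open>D\<close> makes the integral of \<open>Li\<close> finite, so
    that it can be subtracted.\<close>
  have le: "AE Gr in \<nu>. Li Gr \<le> Lo Gr \<and> Li Gr \<le> ennreal (real D)"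
    using assms(2)
  proof eventually_elim
    case (elim Gr)
    interpret brw "fst Gr" D p using elim by (rule brw)
    let ?r = "snd Gr"
    have b: "0 \<le> srw_opR (fst Gr) (q ?r) ?r" "srw_opR (fst Gr) (q ?r) ?r \<le> 1"
      by (auto intro!: srw_opR_bounds simp: q_bounds)
    have "q ?r ?r \<le> srw_opR (fst Gr) (q ?r) ?r"
      using gfR_le[OF p0 b] by (simp add: q_branching[symmetric])
    moreover have "real (deg (fst Gr) ?r) * q ?r ?r \<le> real D * 1"
      using deg_le[of ?r] by (intro mult_mono) (auto simp: q_bounds)
    ultimately show ?case
      unfolding Lo_def Li_def transport_in transport_out by (auto intro!: ennreal_leI mult_left_mono)
  qed
  have "(\<integral>\<^sup>+Gr. Li Gr \<partial>\<nu>) \<le> (\<integral>\<^sup>+Gr. ennreal (real D) \<partial>\<nu>)"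
    using le by (intro nn_integral_mono_AE) auto
  then have fin: "(\<integral>\<^sup>+Gr. Li Gr \<partial>\<nu>) \<noteq> \<infinity>"
    using emeasure_space_1 by (auto simp: top_unique)
  have "(\<integral>\<^sup>+Gr. Lo Gr - Li Gr \<partial>\<nu>) = 0"
    using nn_integral_diff[OF mL fin] le eq fin by auto
  then have "AE Gr in \<nu>. Lo Gr - Li Gr = 0"
    by (subst (asm) nn_integral_0_iff_AE) auto
  with le assms(2) show ?thesis
  proof eventually_elim
    case (elim Gr)
    interpret brw "fst Gr" D p using elim(2) by (rule brw)
    let ?r = "snd Gr"
    have b: "0 \<le> srw_opR (fst Gr) (q ?r) ?r" by (auto intro!: srw_opR_bounds simp: q_bounds)
    \<comment> \<open>Subtraction in \<open>ennreal\<close> is truncated, so a zero difference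
      yields this inequality, the one that \<open>q_zero_one\<close> asks for.\<close>
    have "Lo Gr \<le> Li Gr" using elim(3) by (simp add: diff_eq_0_iff_ennreal)
    then have "real (deg (fst Gr) ?r) * srw_opR (fst Gr) (q ?r) ?r \<le> real (deg (fst Gr) ?r) * q ?r ?r"
      unfolding Lo_def Li_def transport_in transport_out
      by (subst (asm) ennreal_le_iff) (auto simp: q_bounds)
    then have "q ?r ?r = 0 \<or> q ?r ?r = 1"
      by (intro q_zero_one) (simp add: mult_le_cancel_left_pos)
    then show ?case
      using q_less_1_supercritical[of ?r] strongly_recurrent_if_q_0[of ?r] transient_subcritical[of ?r]
      by auto
  qed
qed

end
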